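(* Let $n\ge2$ and $p\in\mathbb{N}$. For any $K\in\mathcal{K}(\mathbb{R}^n)$, one has $$\sum_{\bm j\in\mathcal{J}^n_p}\binom{np}{n-\bm j}^{-1}W_{p,K}(\bm j)\leq\frac{(n!)^p}{(np)!}\sum_{\bm j\in\mathcal{J}^n_p}\binom{np}{n-\bm j}^{-1}\binom{n}{\bm j}|K|^p.$$
   Context: $\mathcal{K}(\mathbb{R}^n)$ denotes the set of convex bodies, i.e. nonempty compact convex subsets of $\mathbb{R}^n$; $|\cdot|$ is Lebesgue measure (in the dimension of the ambient space). The mixed volume of $K_1,\dots,K_N\in\mathcal{K}(\mathbb{R}^N)$ is $V(K_1,\dots,K_N)=\frac1{N!}\frac{\partial^N}{\partial s_1\cdots\partial s_N}\big|_{s_1=\dots=s_N=0}|s_1K_1+\dots+s_NK_N|$ (Minkowski sums; the volume is a homogeneous polynomial of degree $N$ in $s_1,\dots,s_N\ge0$). $L[k]$ means that $L$ is repeated $k$ times. Identify $\mathbb{R}^{pn}=(\mathbb{R}^n)^p$; $\Delta_p(x)=(x,\dots,x)$ is the diagonal embedding $\mathbb{R}^n\to\mathbb{R}^{pn}$ and $\iota_i:\mathbb{R}^n\to\mathbb{R}^{pn}$, $1\le i\le p$, the inclusion into the $i$-th factor. $\mathcal{J}_p^n=\{\bm j=(j_0,\dots,j_p)\in\mathbb{N}_0^{p+1}:j_0+\dots+j_p=n\}$; $\binom{n}{\bm j}=\frac{n!}{j_0!\cdots j_p!}$; $\binom{np}{n-\bm j}=\frac{(np)!}{(n-j_0)!\cdots(n-j_p)!}$;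 $W_{p,K}(\bm j)=V\big(-\Delta_pK[n-j_0],\iota_1K[n-j_1],\dots,\iota_pK[n-j_p]\big)$. *)

theory Defs
  imports "HOL-Analysis.Analysis" "HOL-Library.Set_Algebras"
begin

definition convex_body :: "'a::euclidean_space set \<Rightarrow> bool" where
  "convex_body K \<longleftrightarrow> K \<noteq> {} \<and> compact K \<and> convex K"

text \<open>Partial derivative in the \<open>i\<close>-th variable of a function on the orthant of
  nonnegative parameters: at \<open>s i = 0\<close> this is the right derivative. (The volume of
  \<open>s\<^sub>1 K\<^sub>1 + \<dots> + s\<^sub>N K\<^sub>N\<close> is a polynomial only for nonnegative \<open>s\<^sub>i\<close>.)\<close>

definition partial_deriv ::
    "nat \<Rightarrow> ((nat \<Rightarrow> real) \<Rightarrow> real) \<Rightarrow> (nat \<Rightarrow> real) \<Rightarrow> real" where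
  "partial_deriv i f s = vector_derivative (\<lambda>t. f (s(i := t))) (at (s i) within {0..})"

text \<open>The sum below is the Minkowski sum of sets. The mixed volume is meant for
  lists of length \<open>DIM('a)\<close>; entries are numbered from 0.\<close>

definition volume_of_combination ::
    "'a::euclidean_space set list \<Rightarrow> (nat \<Rightarrow> real) \<Rightarrow> real" where
  "volume_of_combination Ks s =
     measure lebesgue (\<Sum>i<length Ks. (\<lambda>x. s i *\<^sub>R x) ` (Ks ! i))"

definition mixed_volume :: "'a::euclidean_space set list \<Rightarrow> real" where
  "mixed_volume Ks =
     foldr partial_deriv [0..<length Ks] (volume_of_combination Ks) (\<lambda>_. 0)
       / fact (length Ks)"

text \<open>Multi-indices \<open>(j\<^sub>0, \<dots>, j\<^sub>p)\<close> are lists of length \<open>p + 1\<close>.\<close>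

definition multi_indices :: "nat \<Rightarrow> nat \<Rightarrow> nat list set" where
  "multi_indices n p = {j. length j = p + 1 \<and> sum_list j = n}"

definition multinomial :: "nat \<Rightarrow> nat list \<Rightarrow> real" where
  "multinomial m k = fact m / (\<Prod>a\<leftarrow>k. fact a)"

text \<open>\<open>(\<real>\<^sup>n)\<^sup>p\<close> is the type \<open>real ^ 'n ^ 'p\<close>, its factors being
  numbered \<open>1, \<dots>, p\<close> by the bijection \<open>e\<close> from \<open>{1..p}\<close> onto \<open>'p\<close>.
  Thus \<open>vec\<close> is the diagonal embedding, and \<open>axis (e i)\<close> is the inclusion
  into the \<open>i\<close>-th factor.\<close>

definition mixed_W ::
    "nat \<Rightarrow> (nat \<Rightarrow> 'p::finite) \<Rightarrow> (real ^ 'n) set \<Rightarrow> nat list \<Rightarrow> real" where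
  "mixed_W p e K j =
     (let n = CARD('n) in
      mixed_volume
        (replicate (n - j ! 0) ((\<lambda>x. - (vec x :: real ^ 'n ^ 'p)) ` K)
         @ concat (map (\<lambda>i. replicate (n - j ! i) (axis (e i) ` K)) [1..<p + 1])))"

end

theory Submission
  imports Defs "HOL-Computational_Algebra.Polynomial" "HOL-Probability.Distributions"
begin

text \<open>Write \<open>B\<^sub>0 = - \<Delta>\<^sub>p K\<close>, \<open>B\<^sub>i = \<iota>\<^sub>i K\<close> and \<open>D r = r\<^sub>0 B\<^sub>0 + \<dots> + r\<^sub>p B\<^sub>p\<close> for \<open>r \<ge> 0\<close>.
  For \<open>z \<in> (\<real>\<^sup>n)\<^sup>p\<close> let \<open>g z r\<close> be the volume of the set of all \<open>y \<in> r\<^sub>0 K\<close> with \<open>z\<^sub>i + y \<in> r\<^sub>i K\<close>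
  for all \<open>i\<close>. By Fubini, the integral of \<open>g z r\<close> over \<open>z\<close> is \<open>r\<^sub>0\<^sup>n \<cdots> r\<^sub>p\<^sup>n |K|\<^bsup>p+1\<^esup>\<close>; by convexity,
  \<open>g z r \<ge> c\<^sup>n |K|\<close> whenever \<open>z \<in> D (r - (c, \<dots>, c))\<close>. Integrating the second bound over all levels
  \<open>c\<close> yields
  \<open>\<integral> n c\<^bsup>n-1\<^esup> |D (r - (c, \<dots>, c))| dc \<le> |K|\<^sup>p r\<^sub>0\<^sup>n \<cdots> r\<^sub>p\<^sup>n\<close>.
  The Laplace transform of this inequality in \<open>r\<close>, taken at \<open>(1/\<lambda>\<^sub>0, \<dots>, 1/\<lambda>\<^sub>p)\<close>, bounds a polynomial in
  \<open>\<lambda>\<close> whose coefficients are multiples of the mixed volumes by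
  \<open>(\<lambda>\<^sub>0 \<cdots> \<lambda>\<^sub>p)\<^sup>n (1/\<lambda>\<^sub>0 + \<dots> + 1/\<lambda>\<^sub>p)\<^sup>n\<close>, and integrating against \<open>exp (- \<Sum>\<^sub>i \<lambda>\<^sub>i)\<close> gives the claim.

  That \<open>|L + t K|\<close> is a polynomial in \<open>t \<ge> 0\<close> is shown following Gromov: for polytopes
  \<open>L = conv A\<close> and \<open>K = conv B\<close> the gradient of
  \<open>x \<mapsto> ln (\<Sum>a\<in>A. exp (x \<bullet> a)) + t ln (\<Sum>b\<in>B. exp (x \<bullet> b))\<close>
  is a diffeomorphism of the whole space onto the interior of \<open>L + t K\<close>, so the volume is the
  integral of a determinant that is polynomial in \<open>t\<close>. Approximation by polytopes does the rest.\<close>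

section \<open>Polynomials from separate polynomiality\<close>

definition polynomial_on :: "nat \<Rightarrow> real set \<Rightarrow> (real \<Rightarrow> real) \<Rightarrow> bool" where
  "polynomial_on d S f \<longleftrightarrow> (\<exists>p. degree p \<le> d \<and> (\<forall>t\<in>S. f t = poly p t))"

text \<open>Interpolation at \<open>0, \<dots>, d\<close> expresses polynomiality by equations that survive limits and
  integration.\<close>

definition lagrange_poly :: "nat \<Rightarrow> nat \<Rightarrow> real poly" where
  "lagrange_poly d u = (\<Prod>v\<in>{..d} - {u}. smult (inverse (real u - real v)) [:- real v, 1:])"

lemma degree_lagrange_poly: "u \<le> d \<Longrightarrow> degree (lagrange_poly d u) \<le> d"
proof -
  assume "u \<le> d"
  have "degree (lagrange_poly d u)
      \<le> (\<Sum>v\<in>{..d} - {u}. degree (smult (inverse (real u - real v)) [:- real v, 1:]))"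
    unfolding lagrange_poly_def by (rule order.trans[OF degree_prod_sum_le]) (auto simp: o_def)
  also have "\<dots> \<le> (\<Sum>v\<in>{..d} - {u}. 1)"
    by (intro sum_mono) (auto intro: order.trans[OF degree_smult_le])
  finally show ?thesis using \<open>u \<le> d\<close> by simp
qed

lemma poly_lagrange_poly:
  assumes "u \<le> d" "v \<le> d"
  shows "poly (lagrange_poly d u) (real v) = (if u = v then 1 else 0)"
proof (cases "u = v")
  case True
  have "inverse (real v - real w) * (real v - real w) = 1" if "w \<noteq> v" for w
    using that by simp
  then show ?thesis
    using True by (auto simp: lagrange_poly_def poly_prod algebra_simps intro!: prod.neutral)
next
  case False
  then show ?thesis
    using assms by (auto simp: lagrange_poly_def poly_prod intro!: prod_zero)
qed

text \<open>Both sides have degree at most \<open>d\<close> and agree at the \<open>d + 1\<close>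
  nodes \<open>0, ..., d\<close>.\<close>

lemma lagrange_interpolation:
  fixes p :: "real poly"
  assumes "degree p \<le> d"
  shows "poly p t = (\<Sum>u\<le>d. poly p (real u) * poly (lagrange_poly d u) t)"
proof -
  define P where "P = (\<Sum>u\<le>d. smult (poly p (real u)) (lagrange_poly d u))"
  have "degree P \<le> d"
    unfolding P_def
    by (intro degree_sum_le) (auto intro: order.trans[OF degree_smult_le] degree_lagrange_poly)
  moreover have "poly p x = poly P x" if "x \<in> real ` {..d}" for x
    using that by (auto simp: P_def poly_sum poly_lagrange_poly if_distrib cong: if_cong)
  moreover have "card (real ` {..d}) = Suc d"
    by (simp add: card_image)
  ultimately have "p = P"
    using assms by (intro poly_eqI_degree[of "real ` {..d}"]) auto
  then show ?thesis
    by (metis (no_types, lifting) P_def poly_smult poly_sum sum.cong)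
qed

lemma polynomial_on_interpolate:
  assumes "polynomial_on d S f" "range real \<subseteq> S" "t \<in> S"
  shows "f t = (\<Sum>u\<le>d. f (real u) * poly (lagrange_poly d u) t)"
proof -
  obtain p where p: "degree p \<le> d" "\<And>t. t \<in> S \<Longrightarrow> f t = poly p t"
    using assms(1) by (auto simp: polynomial_on_def)
  have "f t = poly p t" using p assms by simp
  also have "\<dots> = (\<Sum>u\<le>d. f (real u) * poly (lagrange_poly d u) t)"
    unfolding lagrange_interpolation[OF p(1), of t] using p(2) assms(2)
    by (intro sum.cong) (auto simp: subset_iff)
  finally show ?thesis .
qed

lemma polynomial_onI_interpolate:
  assumes "\<And>t. t \<in> S \<Longrightarrow> f t = (\<Sum>u\<le>d. c u * poly (lagrange_poly d u) t)"
  shows "polynomial_on d S f"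
  unfolding polynomial_on_def
  by (rule exI[of _ "\<Sum>u\<le>d. smult (c u) (lagrange_poly d u)"])
    (auto simp: assms poly_sum
      intro!: degree_sum_le intro: order.trans[OF degree_smult_le] degree_lagrange_poly)

text \<open>Pointwise convergence suffices: the nodes lie in \<open>S\<close>, so the finite
  interpolation formula passes to the limit term by term. The uniform bound \<open>d\<close> on the
  degrees keeps the number of nodes fixed.\<close>

lemma polynomial_on_limit:
  assumes "\<And>m. polynomial_on d S (F m)" "range real \<subseteq> S"
    and lim: "\<And>t. t \<in> S \<Longrightarrow> (\<lambda>m. F m t) \<longlonglongrightarrow> f t"
  shows "polynomial_on d S f"
proof (rule polynomial_onI_interpolate[where c = "\<lambda>u. f (real u)"])
  fix t assume t: "t \<in> S"
  have "(\<lambda>m. \<Sum>u\<le>d. F m (real u) * poly (lagrange_poly d u) t)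
      \<longlonglongrightarrow> (\<Sum>u\<le>d. f (real u) * poly (lagrange_poly d u) t)"
    using assms(2) by (intro tendsto_intros lim) auto
  moreover have "(\<lambda>m. \<Sum>u\<le>d. F m (real u) * poly (lagrange_poly d u) t) = (\<lambda>m. F m t)"
    using polynomial_on_interpolate[OF assms(1,2) t] by auto
  ultimately show "f t = (\<Sum>u\<le>d. f (real u) * poly (lagrange_poly d u) t)"
    using lim[OF t] LIMSEQ_unique by metis
qed

lemma polynomial_on_linear: "polynomial_on 1 S (\<lambda>t. a + t * b)"
  unfolding polynomial_on_def by (rule exI[of _ "[:a, b:]"]) (auto simp: degree_pCons_le)

lemma polynomial_on_const: "polynomial_on d S (\<lambda>t. a)"
  unfolding polynomial_on_def by (rule exI[of _ "[:a:]"]) auto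

lemma polynomial_on_cmult: "polynomial_on d S f \<Longrightarrow> polynomial_on d S (\<lambda>t. a * f t)"
  unfolding polynomial_on_def
  by (metis degree_smult_le order.trans poly_smult)

lemma polynomial_on_prod:
  assumes "finite I" "\<And>i. i \<in> I \<Longrightarrow> polynomial_on (d i) S (f i)"
  shows "polynomial_on (\<Sum>i\<in>I. d i) S (\<lambda>t. \<Prod>i\<in>I. f i t)"
proof -
  obtain p where p: "\<And>i. i \<in> I \<Longrightarrow> degree (p i) \<le> d i \<and> (\<forall>t\<in>S. f i t = poly (p i) t)"
    using assms(2) unfolding polynomial_on_def by metis
  have "degree (\<Prod>i\<in>I. p i) \<le> (\<Sum>i\<in>I. d i)"
    using p by (intro order.trans[OF degree_prod_sum_le] sum_mono assms) auto
  then show ?thesis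
    unfolding polynomial_on_def using p by (intro exI[of _ "\<Prod>i\<in>I. p i"]) (auto simp: poly_prod)
qed

lemma polynomial_on_sum:
  assumes "\<And>i. i \<in> I \<Longrightarrow> polynomial_on d S (f i)"
  shows "polynomial_on d S (\<lambda>t. \<Sum>i\<in>I. f i t)"
proof (cases "finite I")
  case True
  obtain p where p: "\<And>i. i \<in> I \<Longrightarrow> degree (p i) \<le> d \<and> (\<forall>t\<in>S. f i t = poly (p i) t)"
    using assms unfolding polynomial_on_def by metis
  then show ?thesis
    unfolding polynomial_on_def using True
    by (intro exI[of _ "\<Sum>i\<in>I. p i"]) (auto simp: poly_sum intro!: degree_sum_le)
qed (simp add: polynomial_on_const)

text \<open>Each term of the Leibniz expansion is a product of \<open>CARD('m)\<close> affine
  functions of \<open>t\<close>.\<close>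

lemma polynomial_on_det:
  fixes A B :: "real^'m^'m"
  shows "polynomial_on CARD('m) S (\<lambda>t. det (A + t *\<^sub>R B))"
proof -
  have "polynomial_on (\<Sum>i\<in>(UNIV::'m set). 1) S (\<lambda>t. \<Prod>i\<in>UNIV. A $ i $ \<sigma> i + t * (B $ i $ \<sigma> i))"
    for \<sigma> :: "'m \<Rightarrow> 'm"
    by (intro polynomial_on_prod polynomial_on_linear) auto
  then show ?thesis
    unfolding det_def by (intro polynomial_on_sum polynomial_on_cmult) simp_all
qed

text \<open>If the degree \<open>m\<close> exceeded \<open>n\<close>, then
  \<open>poly p t / t ^ m\<close> would tend to the leading coefficient. The growth bound forces
  this limit to be at most 0 and nonnegativity forces it to be at least 0, but the leading
  coefficient of a nonzero polynomial does not vanish.\<close>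

lemma degree_le_of_growth:
  fixes p :: "real poly"
  assumes bound: "\<And>t. t \<ge> 0 \<Longrightarrow> poly p t \<le> C * (1 + t) ^ n"
    and nonneg: "\<And>t. t \<ge> 0 \<Longrightarrow> 0 \<le> poly p t"
  shows "degree p \<le> n"
proof (rule ccontr)
  assume "\<not> degree p \<le> n"
  define m where "m = degree p"
  have mn: "n < m" using \<open>\<not> degree p \<le> n\<close> by (simp add: m_def)
  have inv: "((\<lambda>t::real. inverse t) \<longlongrightarrow> 0) at_top"
    by (rule tendsto_inverse_0_at_top[OF filterlim_ident])
  \<comment> \<open>The reflected polynomial at \<open>1 / t\<close> is
    \<open>poly p t / t ^ m\<close>, so its continuity at 0 gives the limit at infinity.\<close>
  have "((\<lambda>t. poly (reflect_poly p) (inverse t)) \<longlongrightarrow> poly (reflect_poly p) 0) at_top"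
    by (intro tendsto_intros inv)
  then have 1: "((\<lambda>t. poly (reflect_poly p) (inverse t)) \<longlongrightarrow> lead_coeff p) at_top"
    by (simp add: poly_0_coeff_0)
  have eq: "poly (reflect_poly p) (inverse t) = poly p t * inverse t ^ m" if "t > 0" for t
    using that poly_reflect_poly_nz[of "inverse t" p] by (simp add: m_def mult.commute)
  have "((\<lambda>t. C * (inverse t + 1) ^ n * inverse t ^ (m - n)) \<longlongrightarrow> C * (0 + 1) ^ n * 0 ^ (m - n)) at_top"
    by (intro tendsto_intros inv)
  then have 2: "((\<lambda>t. C * (inverse t + 1) ^ n * inverse t ^ (m - n)) \<longlongrightarrow> 0) at_top"
    using mn by (simp add: power_0_left)
  have "eventually (\<lambda>t. poly (reflect_poly p) (inverse t) \<le> C * (inverse t + 1) ^ n * inverse t ^ (m - n)) at_top"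
    using eventually_gt_at_top[of 0]
  proof eventually_elim
    case (elim t)
    have "poly p t * inverse t ^ m \<le> C * (1 + t) ^ n * inverse t ^ m"
      using elim by (intro mult_right_mono bound) auto
    also have "\<dots> = C * (1 + t) ^ n * (inverse t ^ n * inverse t ^ (m - n))"
      using mn by (simp flip: power_add)
    also have "C * (1 + t) ^ n * (inverse t ^ n * inverse t ^ (m - n))
       = C * ((1 + t) * inverse t) ^ n * inverse t ^ (m - n)"
      by (simp add: power_mult_distrib)
    also have "(1 + t) * inverse t = inverse t + 1"
      using elim by (simp add: field_simps)
    finally show ?case using eq[OF elim] by simp
  qed
  then have le: "lead_coeff p \<le> 0"
    using tendsto_le[OF _ 2 1] by simp
  have "eventually (\<lambda>t. 0 \<le> poly (reflect_poly p) (inverse t)) at_top"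
    using eventually_gt_at_top[of 0] by eventually_elim (auto simp: eq nonneg)
  then have ge: "lead_coeff p \<ge> 0"
    using tendsto_le[OF _ 1 tendsto_const] by simp
  have "lead_coeff p = 0" using le ge by linarith
  then show False using mn by (simp add: m_def)
qed

section \<open>Polynomials in several variables on the nonnegative orthant\<close>

definition monom_eval :: "('q \<Rightarrow> nat) \<Rightarrow> ('q::finite \<Rightarrow> real) \<Rightarrow> real" where
  "monom_eval k r = (\<Prod>q\<in>UNIV. r q ^ k q)"

text \<open>Induction on the set \<open>S\<close> of variables on which \<open>f\<close> depends.
  Interpolation in a new variable \<open>q\<close> writes \<open>f\<close> through its restrictions
  to \<open>r q = 0, ..., d\<close>; these depend on the other variables only, so the induction
  hypothesis applies to each of them.\<close>

lemma separately_polynomial_on_subset: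
  fixes f :: "('q::finite \<Rightarrow> real) \<Rightarrow> real"
  assumes "finite S"
    and "\<And>r q. q \<in> S \<Longrightarrow> (\<And>i. 0 \<le> r i) \<Longrightarrow> polynomial_on d {0..} (\<lambda>t. f (r(q := t)))"
    and "\<And>r r'. (\<And>i. 0 \<le> r i) \<Longrightarrow> (\<And>i. 0 \<le> r' i) \<Longrightarrow> (\<And>i. i \<in> S \<Longrightarrow> r i = r' i) \<Longrightarrow> f r = f r'"
  shows "\<exists>a. \<forall>r. (\<forall>i. 0 \<le> r i) \<longrightarrow>
    f r = (\<Sum>k | (\<forall>q\<in>S. k q \<le> d) \<and> (\<forall>q. q \<notin> S \<longrightarrow> k q = 0). a k * monom_eval k r)"
  using assms
proof (induction S arbitrary: f rule: finite_induct)
  case empty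
  have eq: "{k. (\<forall>q\<in>{}. k q \<le> d) \<and> (\<forall>q. q \<notin> {} \<longrightarrow> k q = 0)} = {\<lambda>_::'q. 0::nat}"
    by auto
  show ?case
  proof (intro exI[of _ "\<lambda>_. f (\<lambda>_. 0)"] allI impI)
    fix r :: "'q \<Rightarrow> real" assume "\<forall>i. 0 \<le> r i"
    then have "f r = f (\<lambda>_. 0)" by (intro empty.prems(2)) auto
    then show "f r = (\<Sum>k | (\<forall>q\<in>{}. k q \<le> d) \<and> (\<forall>q. q \<notin> {} \<longrightarrow> k q = 0). f (\<lambda>_. 0) * monom_eval k r)"
      unfolding eq by (simp add: monom_eval_def)
  qed
next
  case (insert q S)
  define Ks where "Ks = (\<lambda>S. {k::'q \<Rightarrow> nat. (\<forall>q\<in>S. k q \<le> d) \<and> (\<forall>q. q \<notin> S \<longrightarrow> k q = 0)})"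
  have "\<exists>a. \<forall>r. (\<forall>i. 0 \<le> r i) \<longrightarrow> f (r(q := real u)) = (\<Sum>k\<in>Ks S. a k * monom_eval k r)" for u
    unfolding Ks_def
  proof (rule insert.IH)
    fix r :: "'q \<Rightarrow> real" and q' assume "q' \<in> S" "\<And>i. 0 \<le> r i"
    then have "polynomial_on d {0..} (\<lambda>t. f (r(q := real u, q' := t)))"
      by (intro insert.prems(1)) auto
    moreover have "q \<noteq> q'" using \<open>q' \<in> S\<close> insert.hyps by auto
    ultimately show "polynomial_on d {0..} (\<lambda>t. f ((r(q' := t))(q := real u)))"
      by (simp add: fun_upd_twist)
  next
    fix r r' :: "'q \<Rightarrow> real"
    assume "\<And>i. 0 \<le> r i" "\<And>i. 0 \<le> r' i" "\<And>i. i \<in> S \<Longrightarrow> r i = r' i"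
    then show "f (r(q := real u)) = f (r'(q := real u))"
      by (intro insert.prems(2)) auto
  qed
  then obtain a where a: "\<And>u r. (\<forall>i. 0 \<le> r i) \<Longrightarrow>
      f (r(q := real u)) = (\<Sum>k\<in>Ks S. a u k * monom_eval k r)"
    by metis
  define c where "c = (\<lambda>u m. coeff (lagrange_poly d u) m)"
  \<comment> \<open>Expanding the interpolation polynomials into powers of \<open>r q\<close>, the
    coefficient of the monomial \<open>k\<close> collects, over all nodes \<open>u\<close>, the
    coefficient of \<open>k\<close> with the exponent of \<open>q\<close> erased times the
    coefficient of \<open>t ^ k q\<close>.\<close>
  define b where "b = (\<lambda>k. \<Sum>u\<le>d. a u (k(q := 0)) * c u (k q))"
  have lag: "poly (lagrange_poly d u) t = (\<Sum>m\<le>d. c u m * t ^ m)" if "u \<le> d" for u t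
    unfolding poly_altdef c_def
    by (intro sum.mono_neutral_left) (use degree_lagrange_poly[OF that] in \<open>auto simp: coeff_eq_0\<close>)
  have bij: "bij_betw (\<lambda>(k, m). k(q := m)) (Ks S \<times> {..d}) (Ks (insert q S))"
    by (rule bij_betw_byWitness[where f' = "\<lambda>k. (k(q := 0), k q)"])
       (use insert.hyps in \<open>auto simp: Ks_def fun_eq_iff split: if_splits\<close>)
  have mono: "monom_eval (k(q := m)) r = monom_eval k r * r q ^ m" if "k \<in> Ks S" for k m r
  proof -
    have "k q = 0" using that insert.hyps by (auto simp: Ks_def)
    then show ?thesis
      unfolding monom_eval_def
      by (subst (1 2) prod.remove[of UNIV q]) (auto intro!: prod.cong)
  qed
  show ?case
  proof (intro exI[of _ b] allI impI)
    fix r :: "'q \<Rightarrow> real" assume r: "\<forall>i. 0 \<le> r i"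
    have "f r = f (r(q := r q))" by simp
    also have "\<dots> = (\<Sum>u\<le>d. f (r(q := real u)) * poly (lagrange_poly d u) (r q))"
      using r by (intro polynomial_on_interpolate[OF insert.prems(1)]) auto
    also have "\<dots> = (\<Sum>u\<le>d. (\<Sum>k\<in>Ks S. a u k * monom_eval k r) * (\<Sum>m\<le>d. c u m * r q ^ m))"
      by (intro sum.cong refl) (use r in \<open>simp add: lag a\<close>)
    also have "\<dots> = (\<Sum>u\<le>d. \<Sum>(k,m)\<in>Ks S \<times> {..d}. a u k * monom_eval k r * (c u m * r q ^ m))"
      by (simp add: sum_product sum.cartesian_product)
    also have "\<dots> = (\<Sum>(k,m)\<in>Ks S \<times> {..d}. b (k(q := m)) * monom_eval (k(q := m)) r)"
      using insert.hyps
      by (subst sum.swap)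
         (auto simp: b_def mono sum_distrib_left sum_distrib_right Ks_def fun_upd_idem mult_ac intro!: sum.cong)
    also have "\<dots> = (\<Sum>k\<in>Ks (insert q S). b k * monom_eval k r)"
      using sum.reindex_bij_betw[OF bij, of "\<lambda>k. b k * monom_eval k r"]
      by (simp add: case_prod_unfold)
    finally show "f r = (\<Sum>k | (\<forall>q\<in>insert q S. k q \<le> d) \<and> (\<forall>qa. qa \<notin> insert q S \<longrightarrow> k qa = 0).
        b k * monom_eval k r)"
      by (simp add: Ks_def)
  qed
qed

lemma separately_polynomial_imp_polynomial:
  fixes f :: "('q::finite \<Rightarrow> real) \<Rightarrow> real"
  assumes "\<And>r q. (\<And>i. 0 \<le> r i) \<Longrightarrow> polynomial_on d {0..} (\<lambda>t. f (r(q := t)))"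
  obtains a where
    "\<And>r. (\<And>i. 0 \<le> r i) \<Longrightarrow> f r = (\<Sum>k | \<forall>q. k q \<le> d. a k * monom_eval k r)"
proof -
  have "\<exists>a. \<forall>r. (\<forall>i. 0 \<le> r i) \<longrightarrow>
    f r = (\<Sum>k | (\<forall>q\<in>UNIV. k q \<le> d) \<and> (\<forall>q. q \<notin> UNIV \<longrightarrow> k q = 0). a k * monom_eval k r)"
  proof (rule separately_polynomial_on_subset)
    fix r r' :: "'q \<Rightarrow> real" assume "\<And>i. i \<in> UNIV \<Longrightarrow> r i = r' i"
    then have "r = r'" by auto
    then show "f r = f r'" by simp
  qed (use assms in auto)
  then show thesis using that by auto
qed

lemma finite_bounded_exponents: "finite {k :: 'q::finite \<Rightarrow> nat. \<forall>q. k q \<le> d}"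
proof -
  have "{k :: 'q \<Rightarrow> nat. \<forall>q. k q \<le> d} = PiE UNIV (\<lambda>_. {..d})"
    by auto
  then show ?thesis by (simp add: finite_PiE)
qed

lemma monom_eval_scale: "monom_eval k (\<lambda>q. c * r q) = c ^ (\<Sum>q\<in>UNIV. k q) * monom_eval k r"
  by (simp add: monom_eval_def power_mult_distrib prod.distrib power_sum)

text \<open>On the ray through \<open>r\<close>, both the expansion of
  \<open>f (\<lambda>q. c * r q)\<close> and \<open>c ^ N * f r\<close> are polynomials in
  \<open>c\<close>. They agree for infinitely many \<open>c\<close>, so comparing coefficients of
  \<open>c ^ N\<close> leaves exactly the monomials of total degree \<open>N\<close>.\<close>

lemma homogeneous_polynomial_form:
  fixes f :: "('q::finite \<Rightarrow> real) \<Rightarrow> real"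
  assumes f: "\<And>r. (\<And>i. 0 \<le> r i) \<Longrightarrow> f r = (\<Sum>k | \<forall>q. k q \<le> d. a k * monom_eval k r)"
    and hom: "\<And>r c. (\<And>i. 0 \<le> r i) \<Longrightarrow> 0 \<le> c \<Longrightarrow> f (\<lambda>q. c * r q) = c ^ N * f r"
    and r: "\<And>i. 0 \<le> r i"
  shows "f r = (\<Sum>k | (\<forall>q. k q \<le> d) \<and> (\<Sum>q\<in>UNIV. k q) = N. a k * monom_eval k r)"
proof -
  define P where "P = (\<Sum>k | \<forall>q. k q \<le> d. monom (a k * monom_eval k r) (\<Sum>q\<in>UNIV. k q))"
  have "poly P c = poly (monom (f r) N) c" if "c \<in> {0..}" for c
  proof -
    have "poly P c = f (\<lambda>q. c * r q)"
      using that r by (subst f) (auto simp: P_def poly_sum poly_monom monom_eval_scale mult_ac)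
    then show ?thesis using hom[OF r, of c] that by (simp add: poly_monom mult.commute)
  qed
  then have "{0..} \<subseteq> {c. poly (P - monom (f r) N) c = 0}" by auto
  then have "infinite {c. poly (P - monom (f r) N) c = 0}"
    using infinite_Ici finite_subset by blast
  then have "P = monom (f r) N"
    using poly_roots_finite[of "P - monom (f r) N"] by auto
  then have "f r = coeff P N" by simp
  also have "\<dots> = (\<Sum>k | \<forall>q. k q \<le> d. if (\<Sum>q\<in>UNIV. k q) = N then a k * monom_eval k r else 0)"
    by (simp add: P_def coeff_sum)
  also have "\<dots> = (\<Sum>k | (\<forall>q. k q \<le> d) \<and> (\<Sum>q\<in>UNIV. k q) = N. a k * monom_eval k r)"
    by (subst sum.inter_filter[symmetric, OF finite_bounded_exponents]) (auto intro!: sum.cong)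
  finally show ?thesis .
qed

section \<open>The volume of a sum of two polytopes\<close>

text \<open>The Gibbs distribution on \<open>A\<close> with tilt \<open>x\<close>. Its mean is the
  gradient at \<open>x\<close> of \<open>log_sum_exp A\<close>, and its covariance operator
  \<open>gibbs_cov A x\<close> is the Hessian.\<close>

definition gibbs_weight :: "'a::euclidean_space set \<Rightarrow> 'a \<Rightarrow> 'a \<Rightarrow> real" where
  "gibbs_weight A x a = exp (x \<bullet> a) / (\<Sum>b\<in>A. exp (x \<bullet> b))"

definition gibbs_mean :: "'a::euclidean_space set \<Rightarrow> 'a \<Rightarrow> 'a" where
  "gibbs_mean A x = (\<Sum>a\<in>A. gibbs_weight A x a *\<^sub>R a)"

definition gibbs_cov :: "'a::euclidean_space set \<Rightarrow> 'a \<Rightarrow> 'a \<Rightarrow> 'a" where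
  "gibbs_cov A x v = (\<Sum>a\<in>A. (gibbs_weight A x a * (a \<bullet> v - gibbs_mean A x \<bullet> v)) *\<^sub>R a)"

lemma sum_exp_pos: "finite A \<Longrightarrow> A \<noteq> {} \<Longrightarrow> (\<Sum>b\<in>A. exp (x \<bullet> b)) > 0"
  by (intro sum_pos) auto

lemma gibbs_weight_pos: "finite A \<Longrightarrow> A \<noteq> {} \<Longrightarrow> gibbs_weight A x a > 0"
  by (simp add: gibbs_weight_def sum_exp_pos)

lemma sum_gibbs_weight: "finite A \<Longrightarrow> A \<noteq> {} \<Longrightarrow> (\<Sum>a\<in>A. gibbs_weight A x a) = 1"
  using sum_exp_pos[of A x] by (simp add: gibbs_weight_def flip: sum_divide_distrib)

lemma gibbs_mean_in_hull:
  "finite A \<Longrightarrow> A \<noteq> {} \<Longrightarrow> gibbs_mean A x \<in> convex hull A"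
  unfolding gibbs_mean_def
  by (intro convex_sum convex_convex_hull hull_inc sum_gibbs_weight)
     (auto intro: less_imp_le gibbs_weight_pos)

lemma inner_gibbs_mean:
  "gibbs_mean A x \<bullet> v = (\<Sum>b\<in>A. exp (x \<bullet> b) * (v \<bullet> b)) / (\<Sum>b\<in>A. exp (x \<bullet> b))"
  by (simp add: gibbs_mean_def gibbs_weight_def inner_sum_left sum_divide_distrib)
     (simp add: inner_commute)

lemma has_derivative_sum_exp:
  "((\<lambda>x. \<Sum>b\<in>A. exp (x \<bullet> b)) has_derivative (\<lambda>v. \<Sum>b\<in>A. exp (x \<bullet> b) * (v \<bullet> b))) (at x)"
  by (auto intro!: derivative_eq_intros simp: mult.commute)

lemma gibbs_weight_has_derivative:
  assumes "finite A" "A \<noteq> {}"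
  shows "((\<lambda>x. gibbs_weight A x a) has_derivative
    (\<lambda>v. gibbs_weight A x a * (a \<bullet> v - gibbs_mean A x \<bullet> v))) (at x)"
proof -
  define Z where "Z = (\<Sum>b\<in>A. exp (x \<bullet> b))"
  have Z: "Z > 0" using assms by (simp add: Z_def sum_exp_pos)
  have "((\<lambda>x. exp (x \<bullet> a) / (\<Sum>b\<in>A. exp (x \<bullet> b))) has_derivative
     (\<lambda>v. (exp (x \<bullet> a) * (v \<bullet> a) * Z - exp (x \<bullet> a) * (\<Sum>b\<in>A. exp (x \<bullet> b) * (v \<bullet> b))) / (Z * Z))) (at x)"
    unfolding Z_def
    by (rule has_derivative_divide'[OF _ has_derivative_sum_exp])
       (use Z in \<open>auto intro!: derivative_eq_intros simp: Z_def mult.commute\<close>)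
  moreover have "(exp (x \<bullet> a) * (v \<bullet> a) * Z - exp (x \<bullet> a) * (\<Sum>b\<in>A. exp (x \<bullet> b) * (v \<bullet> b))) / (Z * Z)
      = exp (x \<bullet> a) / Z * (a \<bullet> v - gibbs_mean A x \<bullet> v)" for v
    unfolding inner_gibbs_mean Z_def[symmetric] using Z by (simp add: field_simps inner_commute)
  ultimately show ?thesis
    by (simp add: gibbs_weight_def Z_def)
qed

lemma gibbs_mean_has_derivative:
  assumes "finite A" "A \<noteq> {}"
  shows "(gibbs_mean A has_derivative gibbs_cov A x) (at x)"
proof -
  have "((\<lambda>x. \<Sum>a\<in>A. gibbs_weight A x a *\<^sub>R a) has_derivative
      (\<lambda>v. \<Sum>a\<in>A. (gibbs_weight A x a * (a \<bullet> v - gibbs_mean A x \<bullet> v)) *\<^sub>R a)) (at x)"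
    by (intro has_derivative_sum has_derivative_scaleR_left gibbs_weight_has_derivative assms)
  then show ?thesis
    by (simp add: gibbs_mean_def[abs_def] gibbs_cov_def[abs_def])
qed

text \<open>The quadratic form is the variance of \<open>a \<bullet> v\<close>: with mean
  \<open>m\<close>, the variance is the expectation of
  \<open>(a \<bullet> v - m) * (a \<bullet> v)\<close>, because \<open>a \<bullet> v - m\<close> has
  expectation 0.\<close>

lemma inner_gibbs_cov:
  assumes "finite A" "A \<noteq> {}"
  shows "v \<bullet> gibbs_cov A x v = (\<Sum>a\<in>A. gibbs_weight A x a * (a \<bullet> v - gibbs_mean A x \<bullet> v)\<^sup>2)"
proof -
  define m where "m = gibbs_mean A x \<bullet> v"
  have m: "m = (\<Sum>a\<in>A. gibbs_weight A x a * (a \<bullet> v))"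
    by (simp add: m_def gibbs_mean_def inner_sum_left)
  have "(\<Sum>a\<in>A. gibbs_weight A x a * (a \<bullet> v - m)\<^sup>2)
     = (\<Sum>a\<in>A. gibbs_weight A x a * (a \<bullet> v - m) * (a \<bullet> v)) - m * (\<Sum>a\<in>A. gibbs_weight A x a * (a \<bullet> v - m))"
    by (simp add: power2_eq_square algebra_simps sum_subtractf sum_distrib_left sum.distrib)
  also have "(\<Sum>a\<in>A. gibbs_weight A x a * (a \<bullet> v - m)) = 0"
    using sum_gibbs_weight[OF assms, of x]
    by (simp add: right_diff_distrib sum_subtractf m flip: sum_distrib_right)
  finally show ?thesis
    by (simp add: m_def gibbs_cov_def inner_sum_right inner_commute)
qed

lemma gibbs_cov_nonneg:
  assumes "finite A" "A \<noteq> {}"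
  shows "v \<bullet> gibbs_cov A x v \<ge> 0"
  unfolding inner_gibbs_cov[OF assms]
  by (intro sum_nonneg mult_nonneg_nonneg less_imp_le[OF gibbs_weight_pos] assms) auto

text \<open>All weights are positive, so variance 0 would place \<open>A\<close>, and hence its
  convex hull, in a hyperplane orthogonal to \<open>v\<close>. A hyperplane has empty
  interior.\<close>

lemma gibbs_cov_pos:
  assumes "finite A" "interior (convex hull A) \<noteq> {}" "v \<noteq> 0"
  shows "v \<bullet> gibbs_cov A x v > 0"
proof (rule ccontr)
  have A: "A \<noteq> {}" using assms(2) by auto
  assume "\<not> ?thesis"
  then have "v \<bullet> gibbs_cov A x v = 0"
    using gibbs_cov_nonneg[OF assms(1) A, of v x] by simp
  then have "\<forall>a\<in>A. gibbs_weight A x a * (a \<bullet> v - gibbs_mean A x \<bullet> v)\<^sup>2 = 0"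
    unfolding inner_gibbs_cov[OF assms(1) A]
    by (subst (asm) sum_nonneg_eq_0_iff)
       (auto intro!: assms(1) mult_nonneg_nonneg less_imp_le[OF gibbs_weight_pos[OF assms(1) A]])
  then have "a \<bullet> v = gibbs_mean A x \<bullet> v" if "a \<in> A" for a
    using gibbs_weight_pos[OF assms(1) A, of x a] that by auto
  then have "A \<subseteq> {y. v \<bullet> y = gibbs_mean A x \<bullet> v}"
    by (auto simp: inner_commute)
  then have "convex hull A \<subseteq> {y. v \<bullet> y = gibbs_mean A x \<bullet> v}"
    by (intro hull_minimal convex_hyperplane)
  then have "interior (convex hull A) \<subseteq> {}"
    using interior_mono interior_hyperplane[OF assms(3)] by metis
  then show False using assms(2) by simp
qed

section \<open>Convex potentials and their gradient maps\<close>

definition log_sum_exp :: "'a::euclidean_space set \<Rightarrow> 'a \<Rightarrow> real" where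
  "log_sum_exp A x = ln (\<Sum>a\<in>A. exp (x \<bullet> a))"

lemma log_sum_exp_has_derivative:
  assumes "finite A" "A \<noteq> {}"
  shows "(log_sum_exp A has_derivative (\<lambda>v. gibbs_mean A x \<bullet> v)) (at x)"
proof -
  have "((\<lambda>x. ln (\<Sum>a\<in>A. exp (x \<bullet> a))) has_derivative
     (\<lambda>v. (\<Sum>b\<in>A. exp (x \<bullet> b) * (v \<bullet> b)) * inverse (\<Sum>a\<in>A. exp (x \<bullet> a)))) (at x)"
    using sum_exp_pos[OF assms, of x]
    by (auto intro!: derivative_eq_intros has_derivative_sum_exp simp: field_simps)
  then show ?thesis
    by (simp add: log_sum_exp_def[abs_def] inner_gibbs_mean divide_inverse)
qed

text \<open>The potential dominates the support function of the hull: a single exponential is at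
  most the sum of all, and a halfspace containing \<open>A\<close> contains its hull.\<close>

lemma inner_le_log_sum_exp:
  assumes "finite A" "a \<in> convex hull A"
  shows "a \<bullet> x \<le> log_sum_exp A x"
proof -
  have A: "A \<noteq> {}" using assms(2) by auto
  have "b \<bullet> x \<le> log_sum_exp A x" if "b \<in> A" for b
  proof -
    have "exp (x \<bullet> b) \<le> (\<Sum>a\<in>A. exp (x \<bullet> a))"
      using that assms(1) by (intro member_le_sum) auto
    then show ?thesis
      unfolding log_sum_exp_def using sum_exp_pos[OF assms(1) A, of x]
      by (metis exp_le_cancel_iff exp_ln inner_commute)
  qed
  then have "A \<subseteq> {b. x \<bullet> b \<le> log_sum_exp A x}" by (auto simp: inner_commute)
  then have "convex hull A \<subseteq> {b. x \<bullet> b \<le> log_sum_exp A x}"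
    by (intro hull_minimal convex_halfspace_le)
  then show ?thesis using assms(2) by (auto simp: inner_commute)
qed

text \<open>Along the segment from \<open>x\<close> to \<open>y\<close>, with
  \<open>v = y - x\<close>, the component \<open>v \<bullet> T\<close> is strictly increasing, so
  the two endpoints have different images.\<close>

lemma inj_of_positive_derivative:
  fixes T :: "'a::euclidean_space \<Rightarrow> 'a"
  assumes "\<And>x. (T has_derivative T' x) (at x)"
    and "\<And>x v. v \<noteq> 0 \<Longrightarrow> v \<bullet> T' x v > 0"
  shows "inj T"
proof (rule injI, rule ccontr)
  fix x y assume eq: "T x = T y" and "x \<noteq> y"
  define v where "v = y - x"
  have v: "v \<noteq> 0" using \<open>x \<noteq> y\<close> by (simp add: v_def)
  have der: "((\<lambda>s. v \<bullet> T (x + s *\<^sub>R v)) has_real_derivative (v \<bullet> T' (x + s *\<^sub>R v) v)) (at s)" for s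
  proof -
    have "((\<lambda>s. T (x + s *\<^sub>R v)) has_derivative (\<lambda>h. T' (x + s *\<^sub>R v) (h *\<^sub>R v))) (at s)"
      by (rule has_derivative_compose[where f = "\<lambda>s. x + s *\<^sub>R v", OF _ assms(1)])
         (auto intro!: derivative_eq_intros)
    then have "((\<lambda>s. v \<bullet> T (x + s *\<^sub>R v)) has_derivative (\<lambda>h. v \<bullet> T' (x + s *\<^sub>R v) (h *\<^sub>R v))) (at s)"
      by (intro has_derivative_inner_right)
    moreover have "(\<lambda>h. v \<bullet> T' (x + s *\<^sub>R v) (h *\<^sub>R v)) = (*) (v \<bullet> T' (x + s *\<^sub>R v) v)"
      using linear_cmul[OF has_derivative_linear[OF assms(1)]] by (auto simp: mult.commute)
    ultimately show ?thesis by (simp add: has_field_derivative_def)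
  qed
  have "v \<bullet> T (x + 0 *\<^sub>R v) < v \<bullet> T (x + 1 *\<^sub>R v)"
    by (rule DERIV_pos_imp_increasing[OF zero_less_one]) (use der assms(2)[OF v] in blast)
  then show False using eq by (simp add: v_def)
qed

text \<open>Symmetry of \<open>A\<close> is not assumed. The segment from the identity to
  \<open>A\<close> consists of positive definite matrices, which have trivial kernel; the
  determinant along it is therefore never 0, and it starts at 1.\<close>

lemma det_pos_of_positive_definite:
  fixes A :: "real^'m^'m"
  assumes pos: "\<And>v. v \<noteq> 0 \<Longrightarrow> v \<bullet> (A *v v) > 0"
  shows "det A > 0"
proof (rule ccontr)
  assume neg: "\<not> det A > 0"
  define B where "B = (\<lambda>t. mat 1 + t *\<^sub>R (A - mat 1))"
  have cont: "continuous_on {0..1} (\<lambda>t. det (B t))"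
  proof -
    obtain p where "\<And>t. det (B t) = poly p t"
      using polynomial_on_det[of UNIV "mat 1" "A - mat 1"] by (auto simp: polynomial_on_def B_def)
    then show ?thesis by (auto intro!: continuous_intros)
  qed
  have "\<exists>t\<ge>0. t \<le> 1 \<and> det (B t) = 0"
    by (rule IVT2'[where f = "\<lambda>t. det (B t)"]) (use neg cont in \<open>auto simp: B_def\<close>)
  then obtain t where t: "0 \<le> t" "t \<le> 1" "det (B t) = 0" by auto
  then obtain v where v: "v \<noteq> 0" "B t *v v = 0"
    by (metis invertible_det_nz invertible_left_inverse matrix_left_invertible_ker)
  have "B t *v v = (1 - t) *\<^sub>R v + t *\<^sub>R (A *v v)"
    by (simp add: B_def matrix_vector_mult_add_rdistrib matrix_vector_mult_diff_rdistrib
        scaleR_matrix_vector_assoc[symmetric] algebra_simps)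
  then have "0 = (1 - t) * (v \<bullet> v) + t * (v \<bullet> (A *v v))"
    using v(2) by (metis inner_add_right inner_scaleR_right inner_zero_right)
  moreover have "v \<bullet> v > 0" "v \<bullet> (A *v v) > 0" using v pos by auto
  ultimately show False
    using t by (cases "t = 0") (smt (verit, best) mult_nonneg_nonneg mult_pos_pos)+
qed

text \<open>Outside the ball of radius \<open>f 0 / \<delta>\<close> the function exceeds
  \<open>f 0\<close>, so its minimum over that ball is a global one, where the derivative
  vanishes.\<close>

lemma coercive_differentiable_has_critical_point:
  fixes f :: "'a::euclidean_space \<Rightarrow> real"
  assumes der: "\<And>x. (f has_derivative f' x) (at x)"
    and "\<delta> > 0" and coercive: "\<And>x. f x \<ge> \<delta> * norm x"
  obtains x where "f' x = (\<lambda>v. 0)"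
proof -
  define R where "R = f 0 / \<delta>"
  have "f 0 \<ge> 0" using coercive[of 0] by simp
  then have R: "R \<ge> 0" using \<open>\<delta> > 0\<close> by (simp add: R_def)
  have "continuous_on (cball 0 R) f"
    using der by (meson continuous_at_imp_continuous_on has_derivative_continuous)
  then obtain x where x: "x \<in> cball 0 R" "\<And>y. y \<in> cball 0 R \<Longrightarrow> f x \<le> f y"
    using continuous_attains_inf[of "cball 0 R" f] R by auto
  have "f x \<le> f y" for y
  proof (cases "y \<in> cball 0 R")
    case False
    then have "f 0 \<le> \<delta> * norm y"
      using \<open>\<delta> > 0\<close> by (simp add: R_def field_simps)
    then show ?thesis using coercive[of y] x(2)[of 0] R by simp
  qed (use x in auto)
  then have "f' x = (\<lambda>v. 0)"
    by (intro differential_zero_maxmin[OF _ open_UNIV der]) auto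
  then show thesis by (rule that)
qed

text \<open>For \<open>z\<close> in the interior, the sum of the potentials minus the linear
  function \<open>z \<bullet> x\<close> is coercive. At its critical point the gradient of the sum
  of the potentials equals \<open>z\<close>.\<close>

lemma interior_subset_range_gibbs_sum:
  fixes A B :: "'a::euclidean_space set"
  assumes "finite A" "A \<noteq> {}" "finite B" "B \<noteq> {}" "t \<ge> 0"
  shows "interior (convex hull A + (\<lambda>x. t *\<^sub>R x) ` (convex hull B))
    \<subseteq> range (\<lambda>x. gibbs_mean A x + t *\<^sub>R gibbs_mean B x)"
proof
  fix z assume "z \<in> interior (convex hull A + (\<lambda>x. t *\<^sub>R x) ` (convex hull B))"
  then obtain \<delta> where \<delta>: "\<delta> > 0" "cball z \<delta> \<subseteq> convex hull A + (\<lambda>x. t *\<^sub>R x) ` (convex hull B)"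
    by (auto simp: mem_interior_cball)
  define f where "f = (\<lambda>x. log_sum_exp A x + t * log_sum_exp B x - z \<bullet> x)"
  have der: "(f has_derivative (\<lambda>v. (gibbs_mean A x + t *\<^sub>R gibbs_mean B x - z) \<bullet> v)) (at x)" for x
    unfolding f_def
    by (rule derivative_eq_intros log_sum_exp_has_derivative assms refl)+
       (simp add: algebra_simps)
  have coercive: "f x \<ge> \<delta> * norm x" for x
  proof (cases "x = 0")
    case True
    obtain a b where "a \<in> A" "b \<in> B" using assms by auto
    then have "0 \<le> log_sum_exp A 0" "0 \<le> log_sum_exp B 0"
      using inner_le_log_sum_exp[OF assms(1), of a 0] inner_le_log_sum_exp[OF assms(3), of b 0]
      by (auto simp: hull_inc)
    then show ?thesis using True \<open>t \<ge> 0\<close> by (simp add: f_def)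
  next
    case False
    \<comment> \<open>Moving \<open>z\<close> by \<open>\<delta>\<close> in the direction of
      \<open>x\<close> stays inside the sum of polytopes. The support function bound at this point
      then gives the surplus \<open>\<delta> * norm x\<close>.\<close>
    define w where "w = z + (\<delta> / norm x) *\<^sub>R x"
    have "w \<in> cball z \<delta>" using False \<delta>(1) by (simp add: w_def dist_norm)
    then obtain a b where ab: "a \<in> convex hull A" "b \<in> convex hull B" "w = a + t *\<^sub>R b"
      using \<delta>(2) by (auto simp: set_plus_def)
    have "w \<bullet> x \<le> log_sum_exp A x + t * log_sum_exp B x"
      unfolding ab(3) inner_add_left inner_scaleR_left
      by (intro add_mono mult_left_mono inner_le_log_sum_exp assms ab)
    moreover have "w \<bullet> x = z \<bullet> x + \<delta> * norm x"
      using False by (simp add: w_def inner_add_left power2_eq_square flip: power2_norm_eq_inner)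
    ultimately show ?thesis by (simp add: f_def)
  qed
  obtain x where "(\<lambda>v. (gibbs_mean A x + t *\<^sub>R gibbs_mean B x - z) \<bullet> v) = (\<lambda>v. 0)"
    using coercive_differentiable_has_critical_point[OF der \<delta>(1) coercive] by blast
  then have "gibbs_mean A x + t *\<^sub>R gibbs_mean B x - z = 0"
    by (metis inner_eq_zero_iff)
  then show "z \<in> range (\<lambda>x. gibbs_mean A x + t *\<^sub>R gibbs_mean B x)" by auto
qed

text \<open>\<open>S\<close> and \<open>R\<close> differ only inside the frontier of
  \<open>S\<close>, which is negligible for convex sets.\<close>

lemma measure_eq_between_interior:
  fixes S :: "'a::euclidean_space set"
  assumes "convex S" "interior S \<subseteq> R" "R \<subseteq> S" "bounded S"
  shows "R \<in> lmeasurable \<and> measure lebesgue R = measure lebesgue S"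
proof -
  have S: "S \<in> lmeasurable" using assms by (simp add: measurable_convex)
  have "negligible ((S - R) \<union> (R - S))"
    by (rule negligible_subset[OF negligible_convex_frontier[OF assms(1)]])
       (use assms closure_subset in \<open>auto simp: frontier_def\<close>)
  then show ?thesis
    using S lmeasurable_negligible_symdiff[of S R] measure_negligible_symdiff[of S R] by auto
qed

lemma compact_set_plus:
  fixes S T :: "'a::real_normed_vector set"
  assumes "compact S" "compact T"
  shows "compact (S + T)"
proof -
  have "S + T = (\<Union>x\<in>S. \<Union>y\<in>T. {x + y})" by (auto simp: set_plus_def)
  then show ?thesis using compact_sums'[OF assms] by simp
qed

text \<open>The range of the gradient map lies between the interior of the sum and the sum, so the
  volume is the integral of the Jacobian. Full dimension of \<open>convex hull A\<close> alone makes
  the Jacobian positive for every \<open>t \<ge> 0\<close>, whatever the dimension of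
  \<open>convex hull B\<close>.\<close>

lemma polynomial_on_volume_polytope_sum:
  fixes A B :: "(real^'m::{finite,wellorder}) set"
  assumes "finite A" "interior (convex hull A) \<noteq> {}" "finite B" "B \<noteq> {}"
  shows "polynomial_on CARD('m) {0..}
    (\<lambda>t. measure lebesgue (convex hull A + (\<lambda>x. t *\<^sub>R x) ` (convex hull B)))"
proof -
  have A: "A \<noteq> {}" using assms(2) by auto
  define D where "D = (\<lambda>t x. det (matrix (gibbs_cov A x) + t *\<^sub>R matrix (gibbs_cov B x)))"
  define vol where "vol = (\<lambda>t. measure lebesgue (convex hull A + (\<lambda>x. t *\<^sub>R x) ` (convex hull B)))"
  have D: "D t integrable_on UNIV \<and> vol t = integral UNIV (D t)" if t: "t \<ge> 0" for t
  proof -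
    define S where "S = convex hull A + (\<lambda>x. t *\<^sub>R x) ` (convex hull B)"
    define T where "T = (\<lambda>x. gibbs_mean A x + t *\<^sub>R gibbs_mean B x)"
    define T' where "T' = (\<lambda>x v. gibbs_cov A x v + t *\<^sub>R gibbs_cov B x v)"
    have der: "(T has_derivative T' x) (at x)" for x
      unfolding T_def T'_def
      by (intro has_derivative_add has_derivative_scaleR_right gibbs_mean_has_derivative assms A)
    have lin: "linear (gibbs_cov A x)" "linear (gibbs_cov B x)" for x
      using gibbs_mean_has_derivative has_derivative_linear assms A by blast+
    have pos: "v \<bullet> T' x v > 0" if "v \<noteq> 0" for x v
      unfolding T'_def inner_add_right inner_scaleR_right
      by (intro add_pos_nonneg mult_nonneg_nonneg t gibbs_cov_pos gibbs_cov_nonneg assms that)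
    have mat: "matrix (T' x) = matrix (gibbs_cov A x) + t *\<^sub>R matrix (gibbs_cov B x)" for x
      by (simp add: vec_eq_iff matrix_def T'_def)
    have det: "\<bar>det (matrix (T' x))\<bar> = D t x" for x
    proof -
      have "det (matrix (T' x)) > 0"
        by (rule det_pos_of_positive_definite)
           (simp add: matrix_works has_derivative_linear[OF der] pos linear_matrix_vector_mul_eq)
      then show ?thesis by (simp add: D_def mat)
    qed
    have inj: "inj T" by (rule inj_of_positive_derivative[OF der pos])
    have "convex S" unfolding S_def by (intro convex_set_plus convex_scaling convex_convex_hull)
    moreover have "compact S"
      unfolding S_def
      by (intro compact_set_plus compact_scaling finite_imp_compact_convex_hull assms)
    moreover have "interior S \<subseteq> range T"
      unfolding S_def T_def by (intro interior_subset_range_gibbs_sum assms A t)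
    moreover have "range T \<subseteq> S"
      unfolding S_def T_def using gibbs_mean_in_hull assms A by (auto intro!: set_plus_intro)
    ultimately have "range T \<in> lmeasurable" "measure lebesgue (range T) = vol t"
      using measure_eq_between_interior[of S "range T"]
      by (auto simp: compact_imp_bounded vol_def S_def)
    then show ?thesis
      using measurable_differentiable_image_eq[of UNIV T T'] measure_differentiable_image_eq[of UNIV T T']
        der inj det by simp
  qed
  show ?thesis
    unfolding vol_def[symmetric]
  proof (rule polynomial_onI_interpolate[where c = "\<lambda>u. vol (real u)"])
    fix t :: real assume "t \<in> {0..}"
    then have t: "t \<ge> 0" by simp
    \<comment> \<open>Interpolation in \<open>t\<close> is done under the integral sign. Only the
      integrands at the nodes occur, and these are known to be integrable.\<close>
    have "D t = (\<lambda>x. \<Sum>u\<le>CARD('m). D (real u) x * poly (lagrange_poly CARD('m) u) t)"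
      unfolding D_def by (rule ext, rule polynomial_on_interpolate[OF polynomial_on_det[of UNIV]]) auto
    then have "vol t = integral UNIV (\<lambda>x. \<Sum>u\<le>CARD('m). D (real u) x * poly (lagrange_poly CARD('m) u) t)"
      using D[OF t] by simp
    also have "\<dots> = (\<Sum>u\<le>CARD('m). integral UNIV (D (real u)) * poly (lagrange_poly CARD('m) u) t)"
      using D by (subst integral_sum) (auto intro!: integrable_on_mult_left)
    finally show "vol t = (\<Sum>u\<le>CARD('m). vol (real u) * poly (lagrange_poly CARD('m) u) t)"
      using D by simp
  qed
qed

section \<open>The volume of a sum of two convex bodies\<close>

text \<open>The change of variables theorem needs coordinates indexed by a well-ordered type.\<close>

typedef (overloaded) ('a::euclidean_space) dim_index = "{..<DIM('a)}"
  by (rule exI[of _ 0]) (simp add: DIM_positive)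

lemma dim_index_finite_card: "finite (UNIV :: 'a::euclidean_space dim_index set) \<and> CARD('a dim_index) = DIM('a)"
proof -
  have "bij_betw Rep_dim_index (UNIV :: 'a dim_index set) {..<DIM('a)}"
    by (metis type_definition_dim_index bij_betw_def inj_on_def type_definition.Rep_inject type_definition.Rep_range)
  then show ?thesis
    using bij_betw_finite bij_betw_same_card by fastforce
qed

instance dim_index :: (euclidean_space) finite
  by standard (simp add: dim_index_finite_card)

instantiation dim_index :: (euclidean_space) wellorder
begin

definition "i \<le> j \<longleftrightarrow> Rep_dim_index i \<le> Rep_dim_index j"

definition "i < j \<longleftrightarrow> Rep_dim_index i < Rep_dim_index j"

instance
proof
  fix P :: "'a dim_index \<Rightarrow> bool" and a
  assume step: "\<And>x. (\<And>y. y < x \<Longrightarrow> P y) \<Longrightarrow> P x"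
  show "P a"
  proof (induction a rule: measure_induct_rule[of Rep_dim_index])
    case (less x)
    show ?case by (rule step, rule less) (simp add: less_dim_index_def)
  qed
qed (auto simp: less_eq_dim_index_def less_dim_index_def Rep_dim_index_inject)

end

lemma prod_Basis_vec:
  "(\<Prod>b\<in>(Basis :: ('a::euclidean_space^'n) set). f b) = (\<Prod>i\<in>UNIV. \<Prod>u\<in>Basis. f (axis i u))"
proof -
  have bij: "bij_betw (\<lambda>(i, u). axis i u) (UNIV \<times> Basis) (Basis :: ('a^'n) set)"
    by (auto simp: bij_betw_def inj_on_def axis_eq_axis Basis_vec_def nonzero_Basis)
  show ?thesis
    by (simp add: prod.cartesian_product prod.reindex_bij_betw[OF bij, symmetric] case_prod_unfold)
qed

text \<open>The inverse coordinate map pushes Lebesgue measure forward to a measure with the correct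
  values on boxes, and these determine Lebesgue measure.\<close>

lemma measure_preserving_coordinates:
  fixes g :: "'m::finite \<Rightarrow> 'a::euclidean_space"
  assumes g: "bij_betw g UNIV Basis" and S: "S \<in> sets borel"
  shows "measure lebesgue ((\<lambda>y. \<chi> i. y \<bullet> g i) ` S) = measure lebesgue S"
proof -
  define \<phi> where "\<phi> = (\<lambda>x::real^'m. \<Sum>i\<in>UNIV. x $ i *\<^sub>R g i)"
  define \<psi> where "\<psi> = (\<lambda>y::'a. (\<chi> i. y \<bullet> g i) :: real^'m)"
  have gB: "g i \<in> Basis" for i using g by (auto simp: bij_betw_def)
  have gi: "g i \<bullet> g j = (if i = j then 1 else 0)" for i j
    using g by (auto simp: inner_Basis gB bij_betw_def inj_on_def)
  have \<phi>g: "\<phi> x \<bullet> g i = x $ i" for x i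
    by (simp add: \<phi>_def inner_sum_left gi if_distrib cong: if_cong)
  have \<phi>\<psi>: "\<phi> (\<psi> y) = y" for y
    unfolding \<phi>_def \<psi>_def using sum.reindex_bij_betw[OF g, of "\<lambda>b. (y \<bullet> b) *\<^sub>R b"]
    by (simp add: euclidean_representation)
  have \<psi>\<phi>: "\<psi> (\<phi> x) = x" for x
    by (simp add: \<psi>_def \<phi>g vec_eq_iff)
  have cont: "continuous_on UNIV \<phi>" "continuous_on UNIV \<psi>"
    unfolding \<phi>_def \<psi>_def by (intro continuous_intros)+
  have m: "\<phi> \<in> borel_measurable borel" "\<psi> \<in> borel_measurable borel"
    using cont by (auto intro: borel_measurable_continuous_onI)
  have "lborel = distr lborel borel \<phi>"
  proof (rule lborel_eqI)
    fix l u :: 'a assume lu: "\<And>b. b \<in> Basis \<Longrightarrow> l \<bullet> b \<le> u \<bullet> b"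
    have "\<phi> -` box l u = box (\<psi> l) (\<psi> u)"
    proof -
      have "x \<in> \<phi> -` box l u \<longleftrightarrow> (\<forall>b\<in>g ` UNIV. l \<bullet> b < \<phi> x \<bullet> b \<and> \<phi> x \<bullet> b < u \<bullet> b)" for x
        using g by (simp add: mem_box bij_betw_def)
      then show ?thesis by (auto simp: \<phi>g mem_box_cart \<psi>_def)
    qed
    moreover have "emeasure lborel (box (\<psi> l) (\<psi> u)) = (\<Prod>i\<in>UNIV. (u - l) \<bullet> g i)"
    proof (subst emeasure_lborel_box)
      have "\<psi> l $ i \<le> \<psi> u $ i" for i using lu gB by (simp add: \<psi>_def)
      then show "\<psi> l \<bullet> b \<le> \<psi> u \<bullet> b" if "b \<in> Basis" for b
        using that by (auto simp: Basis_vec_def inner_axis)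
      show "ennreal (\<Prod>b\<in>Basis. (\<psi> u - \<psi> l) \<bullet> b) = ennreal (\<Prod>i\<in>UNIV. (u - l) \<bullet> g i)"
        unfolding prod_Basis_vec by (simp add: inner_axis \<psi>_def inner_diff_left)
    qed
    ultimately show "emeasure (distr lborel borel \<phi>) (box l u) = (\<Prod>b\<in>Basis. (u - l) \<bullet> b)"
      using m by (simp add: emeasure_distr prod.reindex_bij_betw[OF g])
  qed simp
  then have "measure lborel S = measure lborel (\<phi> -` S)"
    using m S measure_distr[of \<phi> lborel borel S] by simp
  also have "\<phi> -` S = \<psi> ` S"
    using \<phi>\<psi> \<psi>\<phi> by (auto simp: image_iff) metis
  finally have "measure lborel S = measure lborel (\<psi> ` S)" .
  moreover have "\<psi> ` S \<in> sets borel"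
    using measurable_sets_borel[OF m(1), of S] S unfolding \<open>\<phi> -` S = \<psi> ` S\<close> by simp
  ultimately show ?thesis
    unfolding \<psi>_def using S by simp
qed

lemma image_set_plus_linear: "linear f \<Longrightarrow> f ` (S + T) = f ` S + f ` T"
  by (force simp: set_plus_def linear_add image_iff)

text \<open>Orthonormal coordinates indexed by \<open>'a dim_index\<close> reduce this to the case
  of vectors: the coordinate map is linear, hence commutes with hulls, dilations and sums, and it
  preserves volume.\<close>

lemma polynomial_on_volume_polytope_sum_euclidean:
  fixes A B :: "'a::euclidean_space set"
  assumes "finite A" "interior (convex hull A) \<noteq> {}" "finite B" "B \<noteq> {}"
  shows "polynomial_on DIM('a) {0..}
    (\<lambda>t. measure lebesgue (convex hull A + (\<lambda>x. t *\<^sub>R x) ` (convex hull B)))"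
proof -
  obtain g :: "'a dim_index \<Rightarrow> 'a" where g: "bij_betw g UNIV Basis"
    using finite_same_card_bij[of "UNIV :: 'a dim_index set" "Basis :: 'a set"] dim_index_finite_card
    by auto
  define \<psi> where "\<psi> = (\<lambda>y::'a. (\<chi> i. y \<bullet> g i) :: real^('a dim_index))"
  have lin: "linear \<psi>"
    by (auto simp: \<psi>_def linear_iff vec_eq_iff inner_add_left)
  have inj: "inj \<psi>"
  proof (rule injI, rule euclidean_eqI)
    fix x y b assume "\<psi> x = \<psi> y" "b \<in> (Basis :: 'a set)"
    moreover from this obtain i where "b = g i" using g by (auto simp: bij_betw_def)
    ultimately show "x \<bullet> b = y \<bullet> b" by (simp add: \<psi>_def vec_eq_iff)
  qed
  have surj: "surj \<psi>"
    using linear_injective_imp_surjective[OF lin inj] dim_index_finite_card by simp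
  have "polynomial_on CARD('a dim_index) {0..}
    (\<lambda>t. measure lebesgue (convex hull (\<psi> ` A) + (\<lambda>x. t *\<^sub>R x) ` (convex hull (\<psi> ` B))))"
  proof (rule polynomial_on_volume_polytope_sum)
    show "interior (convex hull (\<psi> ` A)) \<noteq> {}"
      using assms(2) interior_bijective_linear_image[OF lin, of "convex hull A"] inj surj
      by (simp add: convex_hull_linear_image[OF lin, symmetric] bij_def)
  qed (use assms in auto)
  moreover have "measure lebesgue (convex hull (\<psi> ` A) + (\<lambda>x. t *\<^sub>R x) ` (convex hull (\<psi> ` B)))
      = measure lebesgue (convex hull A + (\<lambda>x. t *\<^sub>R x) ` (convex hull B))" for t
  proof -
    have "convex hull (\<psi> ` A) + (\<lambda>x. t *\<^sub>R x) ` (convex hull (\<psi> ` B))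
        = \<psi> ` (convex hull A + (\<lambda>x. t *\<^sub>R x) ` (convex hull B))"
      by (simp add: image_set_plus_linear[OF lin] convex_hull_linear_image[OF lin, symmetric] image_image
          linear_cmul[OF lin])
    moreover have "compact (convex hull A + (\<lambda>x. t *\<^sub>R x) ` (convex hull B))"
      by (intro compact_set_plus compact_scaling finite_imp_compact_convex_hull assms)
    ultimately show ?thesis
      using measure_preserving_coordinates[OF g, of "convex hull A + (\<lambda>x. t *\<^sub>R x) ` (convex hull B)"]
      by (simp add: \<psi>_def borel_compact)
  qed
  ultimately show ?thesis by (simp add: dim_index_finite_card)
qed

text \<open>Compactness covers \<open>K\<close> by finitely many open boxes around points of
  \<open>K\<close>, each within distance \<open>\<epsilon>\<close> of its point; \<open>A\<close>
  collects their corners. The hull contains an open box, so it is full-dimensional even if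
  \<open>K\<close> is not.\<close>

lemma polytope_approximation:
  fixes K :: "'a::euclidean_space set"
  assumes "compact K" "convex K" "K \<noteq> {}" "\<epsilon> > 0"
  obtains A where "finite A" "K \<subseteq> convex hull A" "convex hull A \<subseteq> K + cball 0 \<epsilon>"
    "interior (convex hull A) \<noteq> {}"
proof -
  have "\<exists>a b. x \<in> box a b \<and> cbox a b \<subseteq> ball x \<epsilon>" for x :: 'a
    using open_contains_cbox[OF open_ball, of x x \<epsilon>] \<open>\<epsilon> > 0\<close> by (metis centre_in_ball)
  then obtain l u where lu: "\<And>x::'a. x \<in> box (l x) (u x)" "\<And>x. cbox (l x) (u x) \<subseteq> ball x \<epsilon>"
    by metis
  have "\<exists>V. finite V \<and> cbox (l x) (u x) = convex hull V" for x
    using closed_interval_as_convex_hull by metis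
  then obtain V where V: "\<And>x. finite (V x)" "\<And>x. cbox (l x) (u x) = convex hull V x" by metis
  obtain C where C: "C \<subseteq> K" "finite C" "K \<subseteq> (\<Union>x\<in>C. box (l x) (u x))"
  proof (rule compactE_image[OF assms(1), of K "\<lambda>x. box (l x) (u x)"])
    show "K \<subseteq> (\<Union>x\<in>K. box (l x) (u x))" using lu(1) by auto
  qed (auto simp: open_box)
  define A where "A = (\<Union>x\<in>C. V x)"
  have sub: "cbox (l x) (u x) \<subseteq> convex hull A" if "x \<in> C" for x
    unfolding V(2) using that by (intro hull_mono) (auto simp: A_def)
  show thesis
  proof
    show "finite A" using C V by (auto simp: A_def)
    show "K \<subseteq> convex hull A" using C(3) sub box_subset_cbox by fast
    have "A \<subseteq> K + cball 0 \<epsilon>"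
    proof
      fix a assume "a \<in> A"
      then obtain x where x: "x \<in> C" "a \<in> V x" by (auto simp: A_def)
      then have "a \<in> ball x \<epsilon>" using V(2)[of x] lu(2)[of x] hull_inc[of a "V x" convex] by auto
      then have "a - x \<in> cball 0 \<epsilon>" by (simp add: dist_norm norm_minus_commute)
      then have "x + (a - x) \<in> K + cball 0 \<epsilon>" using x C by (intro set_plus_intro) auto
      then show "a \<in> K + cball 0 \<epsilon>" by simp
    qed
    then show "convex hull A \<subseteq> K + cball 0 \<epsilon>"
      by (intro hull_minimal convex_set_plus assms convex_cball)
    obtain x where "x \<in> C" using C(3) assms(3) by auto
    then have "x \<in> interior (convex hull A)"
      using lu(1)[of x] sub box_subset_cbox by (meson interiorI open_box order.trans)
    then show "interior (convex hull A) \<noteq> {}" by auto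
  qed
qed

text \<open>The parallel bodies decrease to \<open>S\<close>, because \<open>S\<close> is closed,
  and measure is continuous from above on sets of finite measure.\<close>

lemma measure_cball_sum_tendsto:
  fixes S :: "'a::euclidean_space set"
  assumes "compact S" "c \<ge> 0"
  shows "(\<lambda>m. measure lebesgue (S + cball 0 (c / real (Suc m)))) \<longlonglongrightarrow> measure lebesgue S"
proof -
  define U where "U = (\<lambda>m. S + cball (0::'a) (c / real (Suc m)))"
  have comp: "compact (U m)" for m
    unfolding U_def by (intro compact_set_plus assms compact_cball)
  have lm: "U m \<in> lmeasurable" for m by (rule lmeasurable_compact[OF comp])
  have "decseq U"
    unfolding U_def decseq_def
    by (intro allI impI set_plus_mono2 order_refl)
       (auto intro!: subset_cball divide_left_mono assms)
  have "(\<Inter>m. U m) = S"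
  proof
    show "S \<subseteq> (\<Inter>m. U m)"
    proof
      fix x assume "x \<in> S"
      then have "x + 0 \<in> U m" for m
        unfolding U_def using assms by (intro set_plus_intro) auto
      then show "x \<in> (\<Inter>m. U m)" by auto
    qed
    show "(\<Inter>m. U m) \<subseteq> S"
    proof
      fix x assume x: "x \<in> (\<Inter>m. U m)"
      have "\<exists>s\<in>S. dist s x < e" if "e > 0" for e
      proof -
        obtain m where m: "c / e < real (Suc m)"
          using reals_Archimedean2 less_trans of_nat_less_iff lessI by metis
        obtain s b where "s \<in> S" "norm b \<le> c / real (Suc m)" "x = s + b"
          using x by (force simp: U_def set_plus_def)
        moreover have "c / real (Suc m) < e"
          using m that by (simp add: field_simps)
        ultimately show ?thesis by (intro bexI[of _ s]) (auto simp: dist_norm)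
      qed
      then have "x \<in> closure S" by (auto simp: closure_approachable)
      then show "x \<in> S" using compact_imp_closed[OF assms(1)] by simp
    qed
  qed
  moreover have "(\<lambda>m. measure lebesgue (U m)) \<longlonglongrightarrow> measure lebesgue (\<Inter>m. U m)"
    using \<open>decseq U\<close> fmeasurableD[OF lm] fmeasurableD2[OF lm] by (intro Lim_measure_decseq) auto
  ultimately show ?thesis by (simp add: U_def)
qed

text \<open>Both bodies are approximated from outside by polytopes within \<open>1 / Suc m\<close>.
  Their combination lies between the sum \<open>S\<close> and its parallel body of radius
  \<open>(1 + t) / Suc m\<close>, so the volumes converge for each fixed \<open>t\<close> and
  \<open>polynomial_on_limit\<close> applies. Lower-dimensional bodies are covered, as the
  approximating polytopes of \<open>L\<close> have interior points.\<close>

theorem polynomial_on_volume_sum: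
  fixes L K :: "'a::euclidean_space set"
  assumes "convex_body L" "convex_body K"
  shows "polynomial_on DIM('a) {0..} (\<lambda>t. measure lebesgue (L + (\<lambda>x. t *\<^sub>R x) ` K))"
proof -
  have LK: "compact L" "convex L" "L \<noteq> {}" "compact K" "convex K" "K \<noteq> {}"
    using assms by (auto simp: convex_body_def)
  have "\<exists>A. finite A \<and> L \<subseteq> convex hull A \<and> convex hull A \<subseteq> L + cball 0 (1 / real (Suc m))
      \<and> interior (convex hull A) \<noteq> {}" for m
    by (rule polytope_approximation[OF LK(1-3), of "1 / real (Suc m)"]) auto
  then obtain A where A: "\<And>m. finite (A m)" "\<And>m. L \<subseteq> convex hull A m"
      "\<And>m. convex hull A m \<subseteq> L + cball 0 (1 / real (Suc m))" "\<And>m. interior (convex hull A m) \<noteq> {}"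
    by metis
  have "\<exists>A. finite A \<and> K \<subseteq> convex hull A \<and> convex hull A \<subseteq> K + cball 0 (1 / real (Suc m))" for m
    by (rule polytope_approximation[OF LK(4-6), of "1 / real (Suc m)"]) auto
  then obtain B where B: "\<And>m. finite (B m)" "\<And>m. K \<subseteq> convex hull B m"
      "\<And>m. convex hull B m \<subseteq> K + cball 0 (1 / real (Suc m))"
    by metis
  show ?thesis
  proof (rule polynomial_on_limit)
    show "polynomial_on DIM('a) {0..}
        (\<lambda>t. measure lebesgue (convex hull A m + (\<lambda>x. t *\<^sub>R x) ` (convex hull B m)))" for m
      using B(2)[of m] LK(6) by (intro polynomial_on_volume_polytope_sum_euclidean A B) auto
    show "range real \<subseteq> {0..}" by auto
    fix t :: real assume "t \<in> {0..}"
    then have t: "t \<ge> 0" by simp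
    define S where "S = L + (\<lambda>x. t *\<^sub>R x) ` K"
    define P where "P = (\<lambda>m. convex hull A m + (\<lambda>x. t *\<^sub>R x) ` (convex hull B m))"
    have S: "compact S" unfolding S_def by (intro compact_set_plus compact_scaling LK)
    have P: "compact (P m)" for m
      unfolding P_def by (intro compact_set_plus compact_scaling finite_imp_compact_convex_hull A B)
    have 1: "S \<subseteq> P m" for m
      unfolding S_def P_def by (intro set_plus_mono2 image_mono A B)
    have 2: "P m \<subseteq> S + cball 0 ((1 + t) / real (Suc m))" for m
    proof
      fix z assume "z \<in> P m"
      then obtain a b where "a \<in> convex hull A m" "b \<in> convex hull B m" "z = a + t *\<^sub>R b"
        by (auto simp: P_def set_plus_def)
      then obtain x y v w where xy: "x \<in> L" "y \<in> K" "norm v \<le> 1 / real (Suc m)" "norm w \<le> 1 / real (Suc m)"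
          "z = (x + v) + t *\<^sub>R (y + w)"
        using A(3)[of m] B(3)[of m] by (force simp: set_plus_def)
      have "norm (v + t *\<^sub>R w) \<le> 1 / real (Suc m) + t * (1 / real (Suc m))"
        using xy t mult_left_mono[OF xy(4) t] by (intro norm_triangle_le add_mono) auto
      then have "v + t *\<^sub>R w \<in> cball 0 ((1 + t) / real (Suc m))"
        by (simp add: add_divide_distrib)
      then have "(x + t *\<^sub>R y) + (v + t *\<^sub>R w) \<in> S + cball 0 ((1 + t) / real (Suc m))"
        unfolding S_def using xy by (intro set_plus_intro) auto
      then show "z \<in> S + cball 0 ((1 + t) / real (Suc m))"
        using xy by (simp add: algebra_simps)
    qed
    have "(\<lambda>m. measure lebesgue (P m)) \<longlonglongrightarrow> measure lebesgue S"
    proof (rule tendsto_sandwich[OF always_eventually always_eventually tendsto_const])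
      show "\<forall>m. measure lebesgue S \<le> measure lebesgue (P m)"
        using 1 S P by (auto intro!: measure_mono_fmeasurable lmeasurable_compact dest: lmeasurable_compact fmeasurableD)
      show "\<forall>m. measure lebesgue (P m) \<le> measure lebesgue (S + cball 0 ((1 + t) / real (Suc m)))"
        using 2 S P by (auto intro!: measure_mono_fmeasurable lmeasurable_compact compact_set_plus fmeasurableD[OF lmeasurable_compact])
      show "(\<lambda>m. measure lebesgue (S + cball 0 ((1 + t) / real (Suc m)))) \<longlonglongrightarrow> measure lebesgue S"
        using t by (intro measure_cball_sum_tendsto S) auto
    qed
    then show "(\<lambda>m. measure lebesgue (convex hull A m + (\<lambda>x. t *\<^sub>R x) ` (convex hull B m)))
        \<longlonglongrightarrow> measure lebesgue (L + (\<lambda>x. t *\<^sub>R x) ` K)"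
      by (simp add: P_def S_def)
  qed
qed

section \<open>Fibre volumes\<close>

lemma measurable_vec_lambda_lborel:
  "(\<lambda>f. \<chi> i. f i) \<in> (\<Pi>\<^sub>M i\<in>(UNIV::'p::finite set). (lborel :: 'a::euclidean_space measure)) \<rightarrow>\<^sub>M borel"
proof (subst borel_measurable_euclidean_space, intro ballI)
  fix b :: "'a^'p" assume "b \<in> Basis"
  then obtain i u where b: "b = axis i u" by (auto simp: Basis_vec_def)
  have "(\<lambda>f. f i \<bullet> u) \<in> borel_measurable (\<Pi>\<^sub>M i\<in>(UNIV::'p set). (lborel :: 'a measure))"
    by measurable
  then show "(\<lambda>f. (\<chi> i. f i) \<bullet> b) \<in> borel_measurable (\<Pi>\<^sub>M i\<in>(UNIV::'p set). (lborel :: 'a measure))"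
    by (simp add: b inner_axis)
qed

text \<open>Boxes of the power space are products of boxes, so the two measures agree on them. This
  transfers the product rule for integrals to \<open>'a^'p\<close>.\<close>

lemma lborel_vec_eq_distr_PiM:
  "(lborel :: ('a::euclidean_space^'p) measure) = distr (\<Pi>\<^sub>M i\<in>UNIV. lborel) borel (\<lambda>f. \<chi> i. f i)"
proof (rule lborel_eqI)
  interpret product_sigma_finite "\<lambda>_::'p. lborel :: 'a measure" by standard
  fix l u :: "'a^'p" assume lu: "\<And>b. b \<in> Basis \<Longrightarrow> l \<bullet> b \<le> u \<bullet> b"
  have lu': "l $ i \<bullet> b \<le> u $ i \<bullet> b" if "b \<in> Basis" for i b
    using lu[of "axis i b"] that by (auto simp: inner_axis Basis_vec_def)
  have box: "(\<lambda>f. \<chi> i. f i) -` box l u = PiE UNIV (\<lambda>i. box (l $ i) (u $ i))"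
    by (auto simp: mem_box Basis_vec_def inner_axis PiE_iff)
  have "emeasure (distr (\<Pi>\<^sub>M i\<in>UNIV. lborel) borel (\<lambda>f. \<chi> i. f i)) (box l u)
      = emeasure (\<Pi>\<^sub>M i\<in>(UNIV::'p set). (lborel :: 'a measure)) (PiE UNIV (\<lambda>i. box (l $ i) (u $ i)))"
    by (simp add: emeasure_distr[OF measurable_vec_lambda_lborel] box space_PiM)
  also have "\<dots> = (\<Prod>i\<in>UNIV. ennreal (\<Prod>b\<in>Basis. (u $ i - l $ i) \<bullet> b))"
    by (subst emeasure_PiM) (auto simp: emeasure_lborel_box lu')
  also have "\<dots> = ennreal (\<Prod>i\<in>UNIV. \<Prod>b\<in>Basis. (u $ i - l $ i) \<bullet> b)"
    by (intro prod_ennreal prod_nonneg) (auto simp: inner_diff_left lu')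
  also have "(\<Prod>i\<in>UNIV. \<Prod>b\<in>Basis. (u $ i - l $ i) \<bullet> b) = (\<Prod>b\<in>Basis. (u - l) \<bullet> b)"
    unfolding prod_Basis_vec by (simp add: inner_axis)
  finally show "emeasure (distr (\<Pi>\<^sub>M i\<in>UNIV. lborel) borel (\<lambda>f. \<chi> i. f i)) (box l u)
      = ennreal (\<Prod>b\<in>Basis. (u - l) \<bullet> b)" .
qed simp

lemma borel_measurable_vec_nth [measurable]:
  "(\<lambda>x::'a::euclidean_space^'p. x $ i) \<in> borel_measurable borel"
  by (intro borel_measurable_continuous_onI continuous_intros)

lemma nn_integral_prod_vec:
  fixes f :: "'p::finite \<Rightarrow> 'a::euclidean_space \<Rightarrow> ennreal"
  assumes [measurable]: "\<And>i. f i \<in> borel_measurable borel"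
  shows "(\<integral>\<^sup>+x. (\<Prod>i\<in>UNIV. f i (x $ i)) \<partial>lborel) = (\<Prod>i\<in>UNIV. \<integral>\<^sup>+y. f i y \<partial>lborel)"
proof -
  interpret product_sigma_finite "\<lambda>_::'p. lborel :: 'a measure" by standard
  show ?thesis
    by (subst lborel_vec_eq_distr_PiM, subst nn_integral_distr[OF measurable_vec_lambda_lborel])
       (simp_all add: product_nn_integral_prod)
qed

lemma has_bochner_integral_prod_vec:
  fixes f :: "'p::finite \<Rightarrow> 'a::euclidean_space \<Rightarrow> real"
  assumes "\<And>i. has_bochner_integral lborel (f i) (c i)"
  shows "has_bochner_integral lborel (\<lambda>x. \<Prod>i\<in>UNIV. f i (x $ i)) (\<Prod>i\<in>UNIV. c i)"
proof -
  interpret product_sigma_finite "\<lambda>_::'p. lborel :: 'a measure" by standard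
  have [measurable]: "f i \<in> borel_measurable borel" for i
    using assms[of i] by (auto simp: has_bochner_integral_iff)
  have int: "integrable lborel (f i)" "integral\<^sup>L lborel (f i) = c i" for i
    using assms[of i] by (auto simp: has_bochner_integral_iff)
  have "has_bochner_integral (\<Pi>\<^sub>M i\<in>UNIV. lborel) (\<lambda>x. \<Prod>i\<in>UNIV. f i (x i)) (\<Prod>i\<in>UNIV. c i)"
    unfolding has_bochner_integral_iff
    using product_integrable_prod[of UNIV f] product_integral_prod[of UNIV f] int by simp
  then show ?thesis
    by (subst lborel_vec_eq_distr_PiM)
       (simp add: has_bochner_integral_iff integrable_distr_eq[OF measurable_vec_lambda_lborel]
          integral_distr[OF measurable_vec_lambda_lborel])
qed

text \<open>The index \<open>0\<close> of the diagonal summand is represented by \<open>None\<close>.\<close>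

definition summand :: "'a::euclidean_space set \<Rightarrow> 'p::finite option \<Rightarrow> ('a^'p) set" where
  "summand K q = (case q of None \<Rightarrow> (\<lambda>x. - vec x) ` K | Some i \<Rightarrow> axis i ` K)"

text \<open>This is \<open>D r\<close> of the overview, with \<open>r None\<close> as the
  coefficient of the diagonal body.\<close>

definition weighted_sum :: "'a::euclidean_space set \<Rightarrow> ('p::finite option \<Rightarrow> real) \<Rightarrow> ('a^'p) set" where
  "weighted_sum K r = (\<Sum>q\<in>UNIV. (\<lambda>x. r q *\<^sub>R x) ` summand K q)"

lemma sum_option_UNIV: "(\<Sum>q\<in>(UNIV :: 'p::finite option set). f q) = f None + (\<Sum>i\<in>UNIV. f (Some i))"
  by (simp add: UNIV_option_conv sum.reindex)

lemma prod_option_UNIV: "(\<Prod>q\<in>(UNIV :: 'p::finite option set). f q) = f None * (\<Prod>i\<in>UNIV. f (Some i))"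
  by (simp add: UNIV_option_conv prod.reindex)

text \<open>Read coordinatewise: the diagonal summand contributes the same \<open>y\<close> to every
  coordinate, whereas the summand of index \<open>Some i\<close> contributes to coordinate
  \<open>i\<close> alone.\<close>

lemma mem_weighted_sum:
  fixes z :: "'a::euclidean_space^'p"
  shows "z \<in> weighted_sum K r \<longleftrightarrow>
    (\<exists>y\<in>K. \<exists>x. \<forall>i. x $ i \<in> K \<and> z $ i = r (Some i) *\<^sub>R x $ i - r None *\<^sub>R y)"
proof
  assume "z \<in> weighted_sum K r"
  then obtain s where s: "z = (\<Sum>q\<in>UNIV. s q)" "\<And>q. s q \<in> (\<lambda>x. r q *\<^sub>R x) ` summand K q"
    unfolding weighted_sum_def set_sum_alt[OF finite] by auto
  obtain y where y: "y \<in> K" "s None = r None *\<^sub>R - vec y"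
    using s(2)[of None] by (auto simp: summand_def)
  have "\<exists>x. x \<in> K \<and> s (Some i) = r (Some i) *\<^sub>R axis i x" for i
    using s(2)[of "Some i"] by (auto simp: summand_def)
  then obtain x where x: "\<And>i. x i \<in> K" "\<And>i. s (Some i) = r (Some i) *\<^sub>R axis i (x i)" by metis
  have "z $ i = r (Some i) *\<^sub>R x i - r None *\<^sub>R y" for i
    by (simp add: s(1) sum_option_UNIV x(2) y(2) axis_def if_distrib cong: if_cong)
  then show "\<exists>y\<in>K. \<exists>x. \<forall>i. x $ i \<in> K \<and> z $ i = r (Some i) *\<^sub>R x $ i - r None *\<^sub>R y"
    using x(1) y(1) by (intro bexI[of _ y] exI[of _ "\<chi> i. x i"]) auto
next
  assume "\<exists>y\<in>K. \<exists>x. \<forall>i. x $ i \<in> K \<and> z $ i = r (Some i) *\<^sub>R x $ i - r None *\<^sub>R y"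
  then obtain y x where x: "y \<in> K" "\<And>i. x $ i \<in> K" "\<And>i. z $ i = r (Some i) *\<^sub>R x $ i - r None *\<^sub>R y"
    by auto
  define s where "s = (\<lambda>q. case q of None \<Rightarrow> r None *\<^sub>R - vec y | Some i \<Rightarrow> r (Some i) *\<^sub>R axis i (x $ i))"
  have "z = (\<Sum>q\<in>UNIV. s q)"
    by (simp add: vec_eq_iff sum_option_UNIV s_def x(3) axis_def if_distrib cong: if_cong)
  moreover have "s q \<in> (\<lambda>x. r q *\<^sub>R x) ` summand K q" for q
    using x by (cases q) (auto simp: s_def summand_def image_image)
  ultimately show "z \<in> weighted_sum K r"
    unfolding weighted_sum_def set_sum_alt[OF finite] by auto
qed

section \<open>Weighted sums as convex bodies with separately polynomial volume\<close>

lemma convex_body_linear_image: "linear f \<Longrightarrow> convex_body K \<Longrightarrow> convex_body (f ` K)"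
  by (auto simp: convex_body_def convex_linear_image intro!: compact_continuous_image
      linear_continuous_on linear_conv_bounded_linear[THEN iffD1])

lemma linear_neg_vec: "linear (\<lambda>x::'a::euclidean_space. - (vec x :: 'a^'p))"
  by (auto simp: linear_iff vec_eq_iff)

lemma linear_axis: "linear (axis i :: 'a::euclidean_space \<Rightarrow> 'a^'p)"
  by (auto simp: linear_iff vec_eq_iff axis_def)

lemma convex_body_summand: "convex_body K \<Longrightarrow> convex_body (summand K q)"
  by (cases q) (auto simp: summand_def intro!: convex_body_linear_image linear_neg_vec linear_axis)

lemma convex_body_scaleR: "convex_body K \<Longrightarrow> convex_body ((\<lambda>x. c *\<^sub>R x) ` K)"
  by (auto simp: convex_body_def compact_scaling convex_scaling)

lemma convex_body_plus: "convex_body K \<Longrightarrow> convex_body L \<Longrightarrow> convex_body (K + L)"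
  by (auto simp: convex_body_def compact_set_plus convex_set_plus)

lemma convex_body_zero: "convex_body {0}"
  by (simp add: convex_body_def)

lemma convex_body_sum: "(\<And>q. q \<in> I \<Longrightarrow> convex_body (f q)) \<Longrightarrow> convex_body (\<Sum>q\<in>I. f q)"
  by (induction I rule: infinite_finite_induct)
     (auto intro: convex_body_plus simp: convex_body_zero set_zero)

lemma convex_body_weighted_sum: "convex_body K \<Longrightarrow> convex_body (weighted_sum K r)"
  unfolding weighted_sum_def by (intro convex_body_sum convex_body_scaleR convex_body_summand)

text \<open>With all coefficients but one fixed, this is a sum of two bodies. The degree bound is
  the full dimension here; \<open>polynomial_on_volume_weighted_sum_degree\<close> lowers it to
  \<open>DIM('a)\<close>.\<close>

lemma polynomial_on_volume_weighted_sum: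
  fixes K :: "'a::euclidean_space set" and r :: "'p::finite option \<Rightarrow> real"
  assumes "convex_body K"
  shows "polynomial_on DIM('a^'p) {0..} (\<lambda>t. measure lebesgue (weighted_sum K (r(q := t))))"
proof -
  define L where "L = (\<Sum>q'\<in>UNIV - {q}. (\<lambda>x. r q' *\<^sub>R x) ` summand K q')"
  have "weighted_sum K (r(q := t)) = L + (\<lambda>x. t *\<^sub>R x) ` summand K q" for t
    unfolding weighted_sum_def
    by (subst sum.remove[of UNIV q]) (auto simp: L_def add.commute intro!: sum.cong)
  moreover have "convex_body L"
    unfolding L_def by (intro convex_body_sum convex_body_scaleR convex_body_summand assms)
  ultimately show ?thesis
    using polynomial_on_volume_sum[OF _ convex_body_summand[OF assms, of q]] by simp
qed

section \<open>Volumes of the fibres and the inequality over all levels\<close>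

lemma emeasure_lborel_scaleR_compact:
  fixes K :: "'a::euclidean_space set"
  assumes "compact K" "c \<ge> 0"
  shows "emeasure lborel ((\<lambda>x. c *\<^sub>R x + b) ` K) = ennreal (c ^ DIM('a)) * emeasure lborel K"
proof -
  have "compact ((\<lambda>x. c *\<^sub>R x + b) ` K)"
    by (intro compact_continuous_image continuous_intros assms)
  then show ?thesis
    using emeasure_lebesgue_affine[of c b K] assms by (simp add: borel_compact)
qed

text \<open>This is \<open>g z r\<close> of the overview; extended nonnegative values let the order
  of integration be exchanged without integrability conditions.\<close>

definition fibre_volume :: "'a::euclidean_space set \<Rightarrow> ('p::finite option \<Rightarrow> real) \<Rightarrow> 'a^'p \<Rightarrow> ennreal" where
  "fibre_volume K r z = emeasure lborel
     {y \<in> (\<lambda>x. r None *\<^sub>R x) ` K. \<forall>i. z $ i + y \<in> (\<lambda>x. r (Some i) *\<^sub>R x) ` K}"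

lemma fibre_volume_eq_nn_integral:
  assumes "compact K"
  shows "fibre_volume K r z = (\<integral>\<^sup>+y. indicator ((\<lambda>x. r None *\<^sub>R x) ` K) y *
     (\<Prod>i\<in>UNIV. indicator ((\<lambda>x. r (Some i) *\<^sub>R x) ` K) (z $ i + y)) \<partial>lborel)"
proof -
  define A where "A = {y \<in> (\<lambda>x. r None *\<^sub>R x) ` K. \<forall>i. z $ i + y \<in> (\<lambda>x. r (Some i) *\<^sub>R x) ` K}"
  have [measurable]: "(\<lambda>x. r q *\<^sub>R x) ` K \<in> sets borel" for q
    by (intro borel_compact compact_scaling assms)
  have [measurable]: "A \<in> sets borel"
    unfolding A_def by measurable
  have "(\<Prod>i\<in>UNIV. indicator ((\<lambda>x. r (Some i) *\<^sub>R x) ` K) (z $ i + y)) =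
     (if \<forall>i. z $ i + y \<in> (\<lambda>x. r (Some i) *\<^sub>R x) ` K then 1 else 0 :: ennreal)" for y
    by (auto simp: indicator_def)
  then have "indicator A y = (indicator ((\<lambda>x. r None *\<^sub>R x) ` K) y *
     (\<Prod>i\<in>UNIV. indicator ((\<lambda>x. r (Some i) *\<^sub>R x) ` K) (z $ i + y)) :: ennreal)" for y
    by (auto simp: A_def indicator_def)
  moreover have "fibre_volume K r z = (\<integral>\<^sup>+y. indicator A y \<partial>lborel)"
    by (simp add: fibre_volume_def A_def[symmetric])
  ultimately show ?thesis by simp
qed

text \<open>After exchanging the integrals, the integrand for fixed \<open>y\<close> factors over
  the coordinates of \<open>z\<close>, and factor \<open>i\<close> is the indicator of a translate
  of \<open>K\<close> dilated by \<open>r (Some i)\<close>.\<close>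

lemma nn_integral_fibre_volume:
  fixes K :: "'a::euclidean_space set" and r :: "'p::finite option \<Rightarrow> real"
  assumes K: "compact K" and r: "\<And>q. r q \<ge> 0"
  shows "(\<integral>\<^sup>+z. fibre_volume K r z \<partial>lborel)
    = (\<Prod>q\<in>UNIV. ennreal (r q ^ DIM('a)) * emeasure lborel K)"
proof -
  have [measurable]: "(\<lambda>x. r q *\<^sub>R x) ` K \<in> sets borel" for q
    by (intro borel_compact compact_scaling K)
  have 1: "(\<integral>\<^sup>+x. indicator ((\<lambda>x. r (Some i) *\<^sub>R x) ` K) (x + y) \<partial>lborel)
      = ennreal (r (Some i) ^ DIM('a)) * emeasure lborel K" for i y
  proof -
    have "(\<lambda>x. indicator ((\<lambda>x. r (Some i) *\<^sub>R x) ` K) (x + y) :: ennreal)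
       = indicator ((\<lambda>x. r (Some i) *\<^sub>R x + (- y)) ` K)"
      by (auto simp: indicator_def fun_eq_iff image_iff algebra_simps)
    moreover have "(\<lambda>x. r (Some i) *\<^sub>R x + (- y)) ` K \<in> sets borel"
      by (intro borel_compact compact_continuous_image continuous_intros K)
    ultimately show ?thesis
      using emeasure_lborel_scaleR_compact[OF K r, of "Some i" "- y"] by simp
  qed
  have "(\<integral>\<^sup>+z. fibre_volume K r z \<partial>lborel) = (\<integral>\<^sup>+y. \<integral>\<^sup>+z. indicator ((\<lambda>x. r None *\<^sub>R x) ` K) y *
     (\<Prod>i\<in>UNIV. indicator ((\<lambda>x. r (Some i) *\<^sub>R x) ` K) (z $ i + y)) \<partial>lborel \<partial>lborel)"
    unfolding fibre_volume_eq_nn_integral[OF K]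
    by (rule lborel_pair.Fubini') measurable
  also have "\<dots> = (\<integral>\<^sup>+y. indicator ((\<lambda>x. r None *\<^sub>R x) ` K) y *
     (\<Prod>i\<in>(UNIV::'p set). ennreal (r (Some i) ^ DIM('a)) * emeasure lborel K) \<partial>lborel)"
    by (subst nn_integral_cmult, measurable)
       (simp add: nn_integral_prod_vec[of "\<lambda>i x. indicator ((\<lambda>x. r (Some i) *\<^sub>R x) ` K) (x + _)"] 1)
  also have "\<dots> = emeasure lborel ((\<lambda>x. r None *\<^sub>R x) ` K) *
     (\<Prod>i\<in>(UNIV::'p set). ennreal (r (Some i) ^ DIM('a)) * emeasure lborel K)"
    by (subst nn_integral_multc) auto
  finally show ?thesis
    using emeasure_lborel_scaleR_compact[OF K r, of None 0] by (simp add: prod_option_UNIV)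
qed

lemma convex_shrink_mem:
  fixes K :: "'a::real_vector set"
  assumes "convex K" "0 \<le> c" "c \<le> r" "x \<in> K" "k \<in> K"
  shows "(r - c) *\<^sub>R x + c *\<^sub>R k \<in> (\<lambda>x. r *\<^sub>R x) ` K"
proof (cases "r = 0")
  case False
  then have "((r - c) / r) *\<^sub>R x + (c / r) *\<^sub>R k \<in> K"
    using assms by (intro convexD[OF assms(1)]) (auto simp: field_simps)
  moreover have "r *\<^sub>R (((r - c) / r) *\<^sub>R x + (c / r) *\<^sub>R k) = (r - c) *\<^sub>R x + c *\<^sub>R k"
    using False by (simp add: scaleR_add_right)
  ultimately show ?thesis by (metis image_eqI)
qed (use assms in auto)

text \<open>The fibre over a point of the smaller sum contains a translate of \<open>c *\<^sub>R K\<close>.\<close>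

lemma fibre_volume_ge:
  fixes K :: "'a::euclidean_space set" and r :: "'p::finite option \<Rightarrow> real"
  assumes K: "compact K" "convex K" and c: "0 \<le> c" "\<And>q. c \<le> r q"
    and z: "z \<in> weighted_sum K (\<lambda>q. r q - c)"
  shows "ennreal (c ^ DIM('a)) * emeasure lborel K \<le> fibre_volume K r z"
proof -
  obtain y x where y: "y \<in> K" "\<And>i. x $ i \<in> K"
      "\<And>i. z $ i = (r (Some i) - c) *\<^sub>R x $ i - (r None - c) *\<^sub>R y"
    using z unfolding mem_weighted_sum by blast
  define A where "A = {y \<in> (\<lambda>x. r None *\<^sub>R x) ` K. \<forall>i. z $ i + y \<in> (\<lambda>x. r (Some i) *\<^sub>R x) ` K}"
  have [measurable]: "(\<lambda>x. r q *\<^sub>R x) ` K \<in> sets borel" for q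
    by (intro borel_compact compact_scaling K)
  have "A \<in> sets borel"
    unfolding A_def by measurable
  \<comment> \<open>The translation vector comes from the common diagonal point \<open>y\<close> of
    \<open>z\<close>: adding coordinate \<open>i\<close> of \<open>z\<close> cancels it and leaves
    \<open>(r (Some i) - c) *\<^sub>R x $ i + c *\<^sub>R k\<close>, which convexity puts into the
    dilate of \<open>K\<close> by \<open>r (Some i)\<close>.\<close>
  moreover have "(\<lambda>k. c *\<^sub>R k + (r None - c) *\<^sub>R y) ` K \<subseteq> A"
  proof (rule image_subsetI)
    fix k assume k: "k \<in> K"
    have "c *\<^sub>R k + (r None - c) *\<^sub>R y \<in> (\<lambda>x. r None *\<^sub>R x) ` K"
      using convex_shrink_mem[OF K(2) c(1) c(2) y(1) k] by (simp add: add.commute)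
    moreover have "z $ i + (c *\<^sub>R k + (r None - c) *\<^sub>R y) \<in> (\<lambda>x. r (Some i) *\<^sub>R x) ` K" for i
      using convex_shrink_mem[OF K(2) c(1) c(2) y(2)[of i] k, of "Some i"]
      by (simp add: y(3) algebra_simps)
    ultimately show "c *\<^sub>R k + (r None - c) *\<^sub>R y \<in> A" by (simp add: A_def)
  qed
  ultimately have "emeasure lborel ((\<lambda>k. c *\<^sub>R k + (r None - c) *\<^sub>R y) ` K) \<le> emeasure lborel A"
    by (intro emeasure_mono) auto
  then show ?thesis
    using emeasure_lborel_scaleR_compact[OF K(1) c(1)] by (simp add: fibre_volume_def A_def)
qed

lemma compact_vec_set:
  fixes K :: "'a::euclidean_space set"
  assumes "compact K"
  shows "compact {x::'a^'p. \<forall>i. x $ i \<in> K}"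
proof -
  obtain B where B: "\<And>x. x \<in> K \<Longrightarrow> norm x \<le> B"
    using compact_imp_bounded[OF assms] by (auto simp: bounded_iff)
  have "norm x \<le> (\<Sum>i\<in>(UNIV::'p set). B)" if "\<forall>i. x $ i \<in> K" for x :: "'a^'p"
  proof -
    have "norm x \<le> (\<Sum>i\<in>UNIV. norm (x $ i))"
      unfolding norm_vec_def by (rule L2_set_le_sum) simp
    also have "\<dots> \<le> (\<Sum>i\<in>(UNIV::'p set). B)" using that B by (intro sum_mono) auto
    finally show ?thesis .
  qed
  then have "bounded {x::'a^'p. \<forall>i. x $ i \<in> K}" unfolding bounded_iff by blast
  moreover have "closed {x::'a^'p. \<forall>i. x $ i \<in> K}"
    using continuous_closed_vimage[OF compact_imp_closed[OF assms], of "\<lambda>x::'a^'p. x $ _"]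
    by (intro closed_Collect_all) (auto simp: vimage_def intro!: continuous_intros)
  ultimately show ?thesis by (simp add: compact_eq_bounded_closed)
qed

text \<open>The set is the projection of a closed set along the compact set of witnesses
  \<open>(y, x)\<close>. Closedness yields both measurability for Fubini and a largest level
  \<open>c\<close> over each point \<open>z\<close>.\<close>

lemma closed_shifted_sums:
  fixes K :: "'a::euclidean_space set" and r :: "'p::finite option \<Rightarrow> real"
  assumes "compact K"
  shows "closed {(z, c). 0 \<le> c \<and> (\<forall>q. c \<le> r q) \<and> z \<in> weighted_sum K (\<lambda>q. r q - c)}"
proof -
  define X where "X = K \<times> {x::'a^'p. \<forall>i. x $ i \<in> K}"
  define T where "T = {(v::'a \<times> ('a^'p), w::('a^'p) \<times> real). 0 \<le> snd w \<and> (\<forall>q. snd w \<le> r q) \<and>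
     (\<forall>i. fst w $ i = (r (Some i) - snd w) *\<^sub>R snd v $ i - (r None - snd w) *\<^sub>R fst v)}"
  have "compact X" unfolding X_def by (intro compact_Times compact_vec_set assms)
  moreover have "closed T"
    unfolding T_def case_prod_unfold
    by (intro closed_Collect_conj closed_Collect_all closed_Collect_le closed_Collect_eq continuous_intros)
  ultimately have "closed {w. \<exists>v. v \<in> X \<and> (v, w) \<in> T}"
    by (rule closed_compact_projection)
  also have "{w. \<exists>v. v \<in> X \<and> (v, w) \<in> T} =
     {(z, c). 0 \<le> c \<and> (\<forall>q. c \<le> r q) \<and> z \<in> weighted_sum K (\<lambda>q. r q - c)}"
    by (auto simp: X_def T_def mem_weighted_sum) blast+
  finally show ?thesis .
qed

text \<open>The fibre bound at level \<open>c = 1\<close> for the parameters \<open>r q + 1\<close>,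
  integrated over \<open>z\<close>. It controls the growth in each single variable and thereby the
  partial degrees.\<close>

lemma volume_weighted_sum_growth:
  fixes K :: "'a::euclidean_space set" and r :: "'p::finite option \<Rightarrow> real"
  assumes K: "convex_body K" and r: "\<And>q. r q \<ge> 0"
  shows "measure lebesgue K * measure lebesgue (weighted_sum K r)
    \<le> (\<Prod>q\<in>UNIV. (r q + 1) ^ DIM('a) * measure lebesgue K)"
proof -
  have K': "compact K" "convex K" using K by (auto simp: convex_body_def)
  have W: "compact (weighted_sum K r)"
    using convex_body_weighted_sum[OF K] by (auto simp: convex_body_def)
  have emK: "emeasure lborel K = ennreal (measure lebesgue K)"
    using emeasure_eq_measure2[OF lmeasurable_compact[OF K'(1)]] by (simp add: borel_compact K')
  have emW: "emeasure lborel (weighted_sum K r) = ennreal (measure lebesgue (weighted_sum K r))"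
    using emeasure_eq_measure2[OF lmeasurable_compact[OF W]] by (simp add: borel_compact W)
  have "emeasure lborel K * emeasure lborel (weighted_sum K r)
      = (\<integral>\<^sup>+z. emeasure lborel K * indicator (weighted_sum K r) z \<partial>lborel)"
    using W by (simp add: nn_integral_cmult_indicator borel_compact)
  also have "\<dots> \<le> (\<integral>\<^sup>+z. fibre_volume K (\<lambda>q. r q + 1) z \<partial>lborel)"
    using fibre_volume_ge[OF K', of 1 "\<lambda>q. r q + 1"] r
    by (intro nn_integral_mono) (auto simp: indicator_def)
  also have "\<dots> = (\<Prod>q\<in>UNIV. ennreal ((r q + 1) ^ DIM('a)) * emeasure lborel K)"
    by (rule nn_integral_fibre_volume[OF K'(1)]) (simp add: r add_nonneg_nonneg)
  also have "\<dots> = ennreal (\<Prod>q\<in>UNIV. (r q + 1) ^ DIM('a) * measure lebesgue K)"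
    unfolding emK using r by (subst prod_ennreal[symmetric]) (auto simp: ennreal_mult add_nonneg_nonneg)
  finally show ?thesis
    unfolding emK emW using r
    by (subst (asm) ennreal_mult[symmetric]) (auto simp: ennreal_le_iff prod_nonneg add_nonneg_nonneg)
qed

text \<open>A convex body of volume 0 lies in a hyperplane, and then every coordinate of a point of
  the weighted sum lies in a fixed parallel hyperplane.\<close>

lemma volume_weighted_sum_degenerate:
  fixes K :: "'a::euclidean_space set" and r :: "'p::finite option \<Rightarrow> real"
  assumes K: "convex_body K" and "measure lebesgue K = 0"
  shows "measure lebesgue (weighted_sum K r) = 0"
proof -
  have K': "compact K" "convex K" using K by (auto simp: convex_body_def)
  have "negligible K"
    using assms(2) lmeasurable_compact[OF K'(1)] negligible_iff_measure by blast
  then have "interior K = {}" using K'(2) negligible_convex_interior by blast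
  then obtain a b where ab: "a \<noteq> 0" "K \<subseteq> {x. a \<bullet> x = b}"
    using empty_interior_subset_hyperplane[OF K'(2)] by metis
  fix i :: 'p
  have "weighted_sum K r \<subseteq> {z. axis i a \<bullet> z = r (Some i) * b - r None * b}"
  proof
    fix z assume "z \<in> weighted_sum K r"
    then obtain y x where "y \<in> K" "x $ i \<in> K" "z $ i = r (Some i) *\<^sub>R x $ i - r None *\<^sub>R y"
      unfolding mem_weighted_sum by blast
    then show "z \<in> {z. axis i a \<bullet> z = r (Some i) * b - r None * b}"
      using subsetD[OF ab(2), of y] subsetD[OF ab(2), of "x $ i"]
      by (simp add: inner_axis' inner_diff_right)
  qed
  moreover have "axis i a \<noteq> 0" using ab(1) by (simp add: axis_eq_0_iff)
  ultimately have "negligible (weighted_sum K r)"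
    using negligible_hyperplane negligible_subset by blast
  then show ?thesis by (rule negligible_imp_measure0)
qed

lemma nn_integral_power_deriv:
  assumes "n > 0" "b \<ge> 0"
  shows "(\<integral>\<^sup>+c. ennreal (real n * c ^ (n - 1)) * indicator {0..b} c \<partial>lborel) = ennreal (b ^ n)"
proof -
  have "(\<integral>\<^sup>+c. ennreal (real n * c ^ (n - 1)) * indicator {0..b} c \<partial>lborel) = ennreal (b ^ n - 0 ^ n)"
    using assms by (intro nn_integral_FTC_Icc) (auto intro!: derivative_eq_intros)
  then show ?thesis using assms by simp
qed

text \<open>Integrate over \<open>z\<close> first for the left side, and over \<open>c\<close> first
  for the estimate. This bounds \<open>|K|\<close> times the left side by a product with
  \<open>p + 1\<close> factors \<open>|K|\<close>; one factor is cancelled, which is why volume 0 is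
  treated separately.\<close>

lemma shifted_volume_integral_bound:
  fixes K :: "'a::euclidean_space set" and r :: "'p::finite option \<Rightarrow> real"
  assumes K: "convex_body K" and r: "\<And>q. r q \<ge> 0"
  shows "(\<integral>\<^sup>+c. ennreal (real DIM('a) * c ^ (DIM('a) - 1)) * indicator {c. 0 \<le> c \<and> (\<forall>q. c \<le> r q)} c
      * ennreal (measure lebesgue (weighted_sum K (\<lambda>q. r q - c))) \<partial>lborel)
    \<le> ennreal (measure lebesgue K ^ CARD('p) * (\<Prod>q\<in>UNIV. r q ^ DIM('a)))"
proof (cases "measure lebesgue K = 0")
  case True
  then show ?thesis by (simp add: volume_weighted_sum_degenerate[OF K])
next
  case False
  define M where "M = measure lebesgue K"
  define n where "n = DIM('a)"
  have n: "n > 0" by (simp add: n_def)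
  have M: "M > 0" using False by (simp add: M_def zero_less_measure_iff)
  have K': "compact K" "convex K" using K by (auto simp: convex_body_def)
  have emK: "emeasure lborel K = ennreal M"
    using emeasure_eq_measure2[OF lmeasurable_compact[OF K'(1)]] by (simp add: borel_compact K' M_def)
  have W: "compact (weighted_sum K \<rho>)" for \<rho> :: "'p option \<Rightarrow> real"
    using convex_body_weighted_sum[OF K] by (auto simp: convex_body_def)
  have emW: "ennreal (measure lebesgue (weighted_sum K \<rho>)) = emeasure lborel (weighted_sum K \<rho>)"
    for \<rho> :: "'p option \<Rightarrow> real"
    using emeasure_eq_measure2[OF lmeasurable_compact[OF W]] by (simp add: borel_compact W)
  define E where "E = {(z, c). 0 \<le> c \<and> (\<forall>q. c \<le> r q) \<and> z \<in> weighted_sum K (\<lambda>q. r q - c)}"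
  have E: "closed E" unfolding E_def by (rule closed_shifted_sums[OF K'(1)])
  then have "E \<in> sets borel" by (rule borel_closed)
  then have [measurable]: "E \<in> sets (lborel \<Otimes>\<^sub>M lborel)"
    unfolding lborel_prod by simp
  have pointwise: "ennreal M * (\<integral>\<^sup>+c. ennreal (real n * c ^ (n - 1)) * indicator E (z, c) \<partial>lborel)
      \<le> fibre_volume K r z" for z
  proof (cases "\<exists>c. (z, c) \<in> E")
    case True
    define S where "S = {c. (z, c) \<in> E}"
    have "closed (Pair z -` E)"
      by (intro continuous_closed_vimage E) (auto intro!: continuous_intros)
    moreover have "S \<subseteq> {0..r None}" by (auto simp: S_def E_def)
    ultimately have "compact S"
      unfolding S_def vimage_def compact_eq_bounded_closed
      using bounded_subset[OF bounded_closed_interval] by auto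
    moreover have "S \<noteq> {}" using True by (auto simp: S_def)
    \<comment> \<open>All levels over \<open>z\<close> lie between 0 and the largest one,
      \<open>b\<close>, so the integral of \<open>n * c ^ (n - 1)\<close> over them is at most
      \<open>b ^ n\<close>; the fibre bound is then used at level \<open>b\<close> only.\<close>
    ultimately obtain b where b: "b \<in> S" "\<And>c. c \<in> S \<Longrightarrow> c \<le> b"
      using compact_attains_sup by metis
    have b0: "b \<ge> 0" using b(1) by (auto simp: S_def E_def)
    have "(\<integral>\<^sup>+c. ennreal (real n * c ^ (n - 1)) * indicator E (z, c) \<partial>lborel)
        \<le> (\<integral>\<^sup>+c. ennreal (real n * c ^ (n - 1)) * indicator {0..b} c \<partial>lborel)"
    proof (intro nn_integral_mono mult_left_mono)
      fix c
      have "c \<in> {0..b}" if "(z, c) \<in> E"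
        using b(2)[of c] that by (auto simp: S_def E_def)
      then show "(indicator E (z, c) :: ennreal) \<le> indicator {0..b} c"
        by (auto simp: indicator_def)
    qed simp
    also have "\<dots> = ennreal (b ^ n)" by (rule nn_integral_power_deriv[OF n b0])
    finally have "ennreal M * (\<integral>\<^sup>+c. ennreal (real n * c ^ (n - 1)) * indicator E (z, c) \<partial>lborel)
        \<le> ennreal (b ^ n) * emeasure lborel K"
      unfolding emK mult.commute[of "ennreal M"] by (intro mult_right_mono) auto
    also have "\<dots> \<le> fibre_volume K r z"
      unfolding n_def using b(1) by (intro fibre_volume_ge K') (auto simp: S_def E_def)
    finally show ?thesis .
  qed auto
  have "ennreal M * (\<integral>\<^sup>+c. ennreal (real n * c ^ (n - 1)) * indicator {c. 0 \<le> c \<and> (\<forall>q. c \<le> r q)} c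
      * ennreal (measure lebesgue (weighted_sum K (\<lambda>q. r q - c))) \<partial>lborel)
    = ennreal M * (\<integral>\<^sup>+c. \<integral>\<^sup>+z. ennreal (real n * c ^ (n - 1)) * indicator E (z, c) \<partial>lborel \<partial>lborel)"
  proof (intro arg_cong[where f = "\<lambda>x. ennreal M * x"] nn_integral_cong)
    fix c
    have "(\<integral>\<^sup>+z. ennreal (real n * c ^ (n - 1)) * indicator E (z, c) \<partial>lborel)
       = (\<integral>\<^sup>+z. (ennreal (real n * c ^ (n - 1)) * indicator {c. 0 \<le> c \<and> (\<forall>q. c \<le> r q)} c)
          * indicator (weighted_sum K (\<lambda>q. r q - c)) z \<partial>lborel)"
      by (intro nn_integral_cong) (auto simp: E_def indicator_def)
    also have "\<dots> = ennreal (real n * c ^ (n - 1)) * indicator {c. 0 \<le> c \<and> (\<forall>q. c \<le> r q)} c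
        * emeasure lborel (weighted_sum K (\<lambda>q. r q - c))"
      by (rule nn_integral_cmult_indicator) (simp add: borel_compact W)
    finally show "ennreal (real n * c ^ (n - 1)) * indicator {c. 0 \<le> c \<and> (\<forall>q. c \<le> r q)} c
      * ennreal (measure lebesgue (weighted_sum K (\<lambda>q. r q - c)))
      = (\<integral>\<^sup>+z. ennreal (real n * c ^ (n - 1)) * indicator E (z, c) \<partial>lborel)"
      by (simp add: emW)
  qed
  also have "\<dots> = ennreal M * (\<integral>\<^sup>+z. \<integral>\<^sup>+c. ennreal (real n * c ^ (n - 1)) * indicator E (z, c) \<partial>lborel \<partial>lborel)"
    by (subst lborel_pair.Fubini') auto
  also have "\<dots> = (\<integral>\<^sup>+z. ennreal M * (\<integral>\<^sup>+c. ennreal (real n * c ^ (n - 1)) * indicator E (z, c) \<partial>lborel) \<partial>lborel)"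
    by (rule nn_integral_cmult[symmetric]) measurable
  also have "\<dots> \<le> (\<integral>\<^sup>+z. fibre_volume K r z \<partial>lborel)"
    by (intro nn_integral_mono pointwise)
  also have "\<dots> = (\<Prod>q\<in>UNIV. ennreal (r q ^ n) * ennreal M)"
    unfolding n_def emK[symmetric] by (rule nn_integral_fibre_volume[OF K'(1) r])
  also have "\<dots> = ennreal (\<Prod>q\<in>UNIV. r q ^ n * M)"
    using r M by (subst prod_ennreal[symmetric]) (auto simp: ennreal_mult)
  also have "(\<Prod>q\<in>UNIV. r q ^ n * M) = M * (M ^ CARD('p) * (\<Prod>q\<in>UNIV. r q ^ n))"
    by (simp add: prod.distrib)
  also have "ennreal \<dots> = ennreal M * ennreal (M ^ CARD('p) * (\<Prod>q\<in>UNIV. r q ^ n))"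
    using M by (intro ennreal_mult) (auto intro!: prod_nonneg mult_nonneg_nonneg zero_le_power r)
  finally have "ennreal M * (\<integral>\<^sup>+c. ennreal (real n * c ^ (n - 1)) * indicator {c. 0 \<le> c \<and> (\<forall>q. c \<le> r q)} c
      * ennreal (measure lebesgue (weighted_sum K (\<lambda>q. r q - c))) \<partial>lborel)
     \<le> ennreal M * ennreal (M ^ CARD('p) * (\<Prod>q\<in>UNIV. r q ^ n))" .
  then show ?thesis
    using M by (simp add: M_def[symmetric] n_def[symmetric] ennreal_mult_le_mult_iff)
qed

section \<open>Laplace transforms\<close>

lemma multinomial_theorem:
  fixes x :: "'q \<Rightarrow> real"
  assumes "finite S"
  shows "(\<Sum>q\<in>S. x q) ^ n =
    (\<Sum>j | (\<forall>q. q \<notin> S \<longrightarrow> j q = 0) \<and> sum j S = n. fact n / (\<Prod>q\<in>S. fact (j q)) * (\<Prod>q\<in>S. x q ^ j q))"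
  using assms
proof (induction S arbitrary: n rule: finite_induct)
  case empty
  have "{j::'q \<Rightarrow> nat. (\<forall>q. q \<notin> {} \<longrightarrow> j q = 0) \<and> sum j {} = n} = (if n = 0 then {\<lambda>_. 0} else {})"
    by auto
  then show ?case by (simp add: power_0_left)
next
  case (insert q S)
  define Js where "Js = (\<lambda>S n. {j::'q \<Rightarrow> nat. (\<forall>q. q \<notin> S \<longrightarrow> j q = 0) \<and> sum j S = n})"
  \<comment> \<open>\<open>T\<close> omits the factor \<open>fact n\<close>: in the induction step
    the binomial coefficient times \<open>fact (n - m)\<close> is \<open>fact n / fact m\<close>,
    and the last denominator is absorbed into \<open>T\<close> for the larger set.\<close>
  define T where "T = (\<lambda>S j. (\<Prod>q\<in>S. x q ^ j q) / (\<Prod>q\<in>S. fact (j q)))"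
  have IH: "(\<Sum>q\<in>S. x q) ^ m = fact m * (\<Sum>j\<in>Js S m. T S j)" for m
    unfolding insert.IH Js_def T_def by (simp add: sum_distrib_left)
  have fin: "finite (Js S m)" for m
  proof (rule finite_subset)
    show "Js S m \<subseteq> {j. \<forall>q. (q \<in> S \<longrightarrow> j q \<in> {..m}) \<and> (q \<notin> S \<longrightarrow> j q = 0)}"
      using insert.hyps(1) by (auto simp: Js_def intro: member_le_sum)
    show "finite {j::'q \<Rightarrow> nat. \<forall>q. (q \<in> S \<longrightarrow> j q \<in> {..m}) \<and> (q \<notin> S \<longrightarrow> j q = 0)}"
      by (rule finite_set_of_finite_funs) (use insert.hyps in auto)
  qed
  have upd: "sum (j(q := m)) S = sum j S" "T S (j(q := m)) = T S j" for j m
    using insert.hyps by (auto simp: T_def intro!: sum.cong prod.cong arg_cong2[where f = "(/)"])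
  have bij: "bij_betw (\<lambda>(m, j). j(q := m)) (SIGMA m:{..n}. Js S (n - m)) (Js (insert q S) n)"
  proof (rule bij_betw_byWitness[where f' = "\<lambda>j. (j q, j(q := 0))"])
    show "\<forall>a\<in>SIGMA m:{..n}. Js S (n - m). (\<lambda>j. (j q, j(q := 0))) ((\<lambda>(m, j). j(q := m)) a) = a"
      using insert.hyps by (auto simp: Js_def fun_eq_iff)
    show "\<forall>a'\<in>Js (insert q S) n. (\<lambda>(m, j). j(q := m)) ((\<lambda>j. (j q, j(q := 0))) a') = a'"
      by auto
    show "(\<lambda>(m, j). j(q := m)) ` (SIGMA m:{..n}. Js S (n - m)) \<subseteq> Js (insert q S) n"
      using insert.hyps upd(1) by (auto simp: Js_def)
    show "(\<lambda>j. (j q, j(q := 0))) ` Js (insert q S) n \<subseteq> (SIGMA m:{..n}. Js S (n - m))"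
      using insert.hyps upd(1) by (auto simp: Js_def)
  qed
  have "(\<Sum>q\<in>insert q S. x q) ^ n = (x q + (\<Sum>q\<in>S. x q)) ^ n"
    using insert.hyps by simp
  also have "\<dots> = (\<Sum>m\<le>n. real (n choose m) * x q ^ m * (\<Sum>q\<in>S. x q) ^ (n - m))"
    by (rule binomial_ring)
  also have "\<dots> = (\<Sum>m\<le>n. \<Sum>j\<in>Js S (n - m). fact n * T (insert q S) (j(q := m)))"
  proof (intro sum.cong refl)
    fix m assume "m \<in> {..n}"
    then have b: "real (n choose m) * fact (n - m) = fact n / fact m"
      by (simp add: binomial_fact field_simps)
    have "real (n choose m) * x q ^ m * (\<Sum>q\<in>S. x q) ^ (n - m)
        = (real (n choose m) * fact (n - m)) * (x q ^ m * (\<Sum>j\<in>Js S (n - m). T S j))"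
      by (simp add: IH mult_ac)
    also have "\<dots> = (\<Sum>j\<in>Js S (n - m). fact n * (x q ^ m / fact m * T S j))"
      unfolding b by (simp add: sum_distrib_left)
    also have "\<dots> = (\<Sum>j\<in>Js S (n - m). fact n * T (insert q S) (j(q := m)))"
    proof (intro sum.cong refl)
      fix j
      have "T (insert q S) (j(q := m)) = x q ^ m / fact m * T S (j(q := m))"
        using insert.hyps by (simp add: T_def)
      then show "fact n * (x q ^ m / fact m * T S j) = fact n * T (insert q S) (j(q := m))"
        by (simp add: upd)
    qed
    finally show "real (n choose m) * x q ^ m * (\<Sum>q\<in>S. x q) ^ (n - m)
      = (\<Sum>j\<in>Js S (n - m). fact n * T (insert q S) (j(q := m)))" .
  qed
  also have "\<dots> = (\<Sum>(m, j)\<in>(SIGMA m:{..n}. Js S (n - m)). fact n * T (insert q S) (j(q := m)))"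
    using fin by (subst sum.Sigma) auto
  also have "\<dots> = (\<Sum>j\<in>Js (insert q S) n. fact n * T (insert q S) j)"
    using sum.reindex_bij_betw[OF bij, of "\<lambda>j. fact n * T (insert q S) j"]
    by (simp add: case_prod_unfold)
  finally show ?case
    by (simp add: Js_def T_def)
qed

lemma finite_exponents_of_degree: "finite {j :: 'q::finite \<Rightarrow> nat. (\<Sum>q\<in>UNIV. j q) = n}"
  by (rule finite_subset[OF _ finite_bounded_exponents[of n]]) (auto intro: member_le_sum)

text \<open>Every exponent satisfies \<open>j q \<le> n\<close>, so the reciprocal powers are
  absorbed by \<open>x q ^ n\<close>. The resulting exponents \<open>n - j q\<close> are the
  multiplicities that occur in the mixed volumes.\<close>

lemma multinomial_theorem_reciprocal:
  fixes x :: "'q::finite \<Rightarrow> real"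
  assumes "\<And>q. x q > 0"
  shows "(\<Prod>q\<in>UNIV. x q ^ n) * (\<Sum>q\<in>UNIV. 1 / x q) ^ n =
    (\<Sum>j | (\<Sum>q\<in>UNIV. j q) = n. fact n / (\<Prod>q\<in>UNIV. fact (j q)) * monom_eval (\<lambda>q. n - j q) x)"
proof -
  have "(\<Prod>q\<in>UNIV. x q ^ n) * (\<Prod>q\<in>UNIV. (1 / x q) ^ j q) = monom_eval (\<lambda>q. n - j q) x"
    if "(\<Sum>q\<in>UNIV. j q) = n" for j
  proof -
    have "j q \<le> n" for q using that by (auto intro: member_le_sum)
    then have "x q ^ n * (1 / x q) ^ j q = x q ^ (n - j q)" for q
      using assms[of q] by (simp add: power_diff power_one_over divide_inverse power_inverse)
    then show ?thesis by (simp add: monom_eval_def flip: prod.distrib)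
  qed
  then show ?thesis
    by (subst multinomial_theorem) (auto simp: sum_distrib_left mult.left_commute intro!: sum.cong)
qed

text \<open>The joint density of independent standard exponential variables, under which monomials
  integrate to products of factorials. It is supported in the open orthant so that reciprocals of
  coordinates make sense wherever it is nonzero.\<close>

definition exp_weight :: "real^'q::finite \<Rightarrow> real" where
  "exp_weight s = (\<Prod>q\<in>UNIV. indicator {0<..} (s $ q) * exp (- (s $ q)))"

lemma exp_weight_nonneg: "exp_weight s \<ge> 0"
  unfolding exp_weight_def by (intro prod_nonneg) auto

lemma exp_weight_nonzero_imp_pos: "exp_weight s \<noteq> 0 \<Longrightarrow> s $ q > 0"
  unfolding exp_weight_def by (auto simp: indicator_def split: if_splits)

lemma borel_measurable_exp_weight [measurable]: "exp_weight \<in> borel_measurable borel"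
  unfolding exp_weight_def[abs_def] by measurable

lemma has_bochner_integral_power_exp:
  "has_bochner_integral lborel (\<lambda>x. indicator {0<..} x * exp (- x) * x ^ k :: real) (fact k)"
proof (rule has_bochner_integral_nn_integral)
  have "(\<integral>\<^sup>+x. ennreal (indicator {0<..} x * exp (- x) * x ^ k) \<partial>lborel)
      = (\<integral>\<^sup>+x. ennreal (x ^ k * exp (- x)) * indicator {0..} x \<partial>lborel)"
  proof (rule nn_integral_cong_AE)
    show "AE x in lborel. ennreal (indicator {0<..} x * exp (- x) * x ^ k)
       = ennreal (x ^ k * exp (- x)) * indicator {0..} x"
      using AE_lborel_singleton[of 0]
      by eventually_elim (auto simp: indicator_def mult.commute)
  qed
  then show "(\<integral>\<^sup>+x. ennreal (indicator {0<..} x * exp (- x) * x ^ k) \<partial>lborel) = ennreal (fact k)"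
    by (simp add: nn_intergal_power_times_exp_Ici)
qed (auto simp: indicator_def)

lemma has_bochner_integral_exp_weight_monom:
  fixes k :: "'q::finite \<Rightarrow> nat"
  shows "has_bochner_integral lborel (\<lambda>s. exp_weight s * monom_eval k (\<lambda>q. s $ q)) (\<Prod>q\<in>UNIV. fact (k q))"
proof -
  have "has_bochner_integral lborel
     (\<lambda>s::real^'q. \<Prod>q\<in>UNIV. indicator {0<..} (s $ q) * exp (- (s $ q)) * (s $ q) ^ k q) (\<Prod>q\<in>UNIV. fact (k q))"
    by (rule has_bochner_integral_prod_vec[OF has_bochner_integral_power_exp])
  then show ?thesis
    by (simp add: exp_weight_def monom_eval_def prod.distrib)
qed

lemma has_bochner_integral_exp_weight_polynomial:
  fixes \<kappa> :: "'i \<Rightarrow> 'q::finite \<Rightarrow> nat"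
  assumes "finite J"
  shows "has_bochner_integral lborel (\<lambda>s. exp_weight s * (\<Sum>k\<in>J. a k * monom_eval (\<kappa> k) (\<lambda>q. s $ q)))
    (\<Sum>k\<in>J. a k * (\<Prod>q\<in>UNIV. fact (\<kappa> k q)))"
proof -
  have "has_bochner_integral lborel (\<lambda>s. \<Sum>k\<in>J. a k * (exp_weight s * monom_eval (\<kappa> k) (\<lambda>q. s $ q)))
     (\<Sum>k\<in>J. a k * (\<Prod>q\<in>UNIV. fact (\<kappa> k q)))"
    by (intro has_bochner_integral_sum has_bochner_integral_mult_right has_bochner_integral_exp_weight_monom)
  then show ?thesis by (simp add: sum_distrib_left mult.left_commute)
qed

lemma nn_integral_power_deriv_exp:
  assumes "n > 0" "\<sigma> > 0"
  shows "(\<integral>\<^sup>+c. ennreal (real n * c ^ (n - 1)) * indicator {0..} c * ennreal (exp (- (c * \<sigma>))) \<partial>lborel)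
    = ennreal (fact n / \<sigma> ^ n)"
proof -
  obtain m where n: "n = Suc m" using assms(1) by (cases n) auto
  have "(\<integral>\<^sup>+c. ennreal (real n * c ^ (n - 1)) * indicator {0..} c * ennreal (exp (- (c * \<sigma>))) \<partial>lborel)
     = ennreal \<bar>1 / \<sigma>\<bar> * (\<integral>\<^sup>+x. ennreal (real n * (0 + 1 / \<sigma> * x) ^ (n - 1)) * indicator {0..} (0 + 1 / \<sigma> * x)
         * ennreal (exp (- ((0 + 1 / \<sigma> * x) * \<sigma>))) \<partial>lborel)"
    using assms by (intro nn_integral_real_affine) auto
  also have "(\<integral>\<^sup>+x. ennreal (real n * (0 + 1 / \<sigma> * x) ^ (n - 1)) * indicator {0..} (0 + 1 / \<sigma> * x)
         * ennreal (exp (- ((0 + 1 / \<sigma> * x) * \<sigma>))) \<partial>lborel)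
     = (\<integral>\<^sup>+x. ennreal (real n / \<sigma> ^ m) * (ennreal (x ^ m * exp (- x)) * indicator {0..} x) \<partial>lborel)"
    using assms
    by (intro nn_integral_cong)
       (auto simp: n indicator_def zero_le_divide_iff power_divide field_simps simp flip: ennreal_mult)
  also have "\<dots> = ennreal (real n / \<sigma> ^ m) * ennreal (fact m)"
    by (subst nn_integral_cmult) (auto simp: nn_intergal_power_times_exp_Ici)
  finally show ?thesis
    using assms by (simp add: n field_simps flip: ennreal_mult)
qed

section \<open>The Laplace transform of the inequality over levels\<close>

lemma nn_integral_lborel_translate:
  fixes g :: "'a::euclidean_space \<Rightarrow> ennreal"
  assumes "g \<in> borel_measurable borel"
  shows "(\<integral>\<^sup>+s. g s \<partial>lborel) = (\<integral>\<^sup>+s. g (d + s) \<partial>lborel)"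
  by (subst lborel_distr_plus[of d, symmetric], subst nn_integral_distr) (use assms in auto)

text \<open>All geometry enters through \<open>nonneg\<close> and \<open>bound\<close>: in the
  application \<open>P r\<close> is the volume of the weighted sum on the orthant and
  \<open>C\<close> is \<open>|K| ^ p\<close>.\<close>

locale shifted_integral_bound =
  fixes J :: "('q::finite \<Rightarrow> nat) set" and a :: "('q \<Rightarrow> nat) \<Rightarrow> real" and n :: nat and C :: real
    and P :: "('q \<Rightarrow> real) \<Rightarrow> real"
  assumes J: "finite J" and n: "n > 0" and C: "C \<ge> 0"
    and P: "P r = (\<Sum>k\<in>J. a k * monom_eval k r)"
    and nonneg: "(\<And>q. 0 \<le> r q) \<Longrightarrow> 0 \<le> P r"
    and bound: "(\<And>q. 0 \<le> r q) \<Longrightarrow>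
      (\<integral>\<^sup>+c. ennreal (real n * c ^ (n - 1)) * indicator {c. 0 \<le> c \<and> (\<forall>q. c \<le> r q)} c
        * ennreal (P (\<lambda>q. r q - c)) \<partial>lborel) \<le> ennreal (C * (\<Prod>q\<in>UNIV. r q ^ n))"
begin

text \<open>Put \<open>r q = l q * s $ q\<close> in \<open>bound\<close> and integrate against
  \<open>exp_weight s\<close>. On the left, exchange the integrals and translate \<open>s\<close> by
  the vector of the \<open>c / l q\<close>: the weight releases
  \<open>exp (- (c * \<sigma>))\<close>, whose integral against \<open>n * c ^ (n - 1)\<close> is
  \<open>fact n / \<sigma> ^ n\<close>. On the right a single monomial is integrated.\<close>

lemma laplace_bound:
  assumes l: "\<And>q. l q > 0"
  shows "fact n * (\<Sum>k\<in>J. a k * monom_eval k l * (\<Prod>q\<in>UNIV. fact (k q)))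
    \<le> C * fact n ^ CARD('q) * ((\<Prod>q\<in>UNIV. l q ^ n) * (\<Sum>q\<in>UNIV. 1 / l q) ^ n)"
proof -
  define Q where "Q = (\<Sum>k\<in>J. a k * monom_eval k l * (\<Prod>q\<in>UNIV. fact (k q)))"
  define \<sigma> where "\<sigma> = (\<Sum>q\<in>UNIV. 1 / l q)"
  have \<sigma>: "\<sigma> > 0" unfolding \<sigma>_def using l by (intro sum_pos) auto
  have scale: "monom_eval k (\<lambda>q. l q * s $ q) = monom_eval k l * monom_eval k (\<lambda>q. s $ q)"
    for k :: "'q \<Rightarrow> nat" and s :: "real^'q"
    by (simp add: monom_eval_def power_mult_distrib prod.distrib)
  have [measurable]: "(\<lambda>x. P (\<lambda>q. f q x)) \<in> borel_measurable N"
    if [measurable]: "\<And>q. f q \<in> borel_measurable N" for f and N :: "'z measure"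
    unfolding P monom_eval_def by measurable
  have hb: "has_bochner_integral lborel (\<lambda>s. exp_weight s * P (\<lambda>q. l q * s $ q)) Q"
    using has_bochner_integral_exp_weight_polynomial[OF J, of "\<lambda>k. a k * monom_eval k l" "\<lambda>k. k"]
    by (simp add: P scale Q_def mult.assoc)
  have wP: "exp_weight s * P (\<lambda>q. l q * s $ q) \<ge> 0" for s
  proof (cases "exp_weight s = 0")
    case False
    have "l q * s $ q \<ge> 0" for q
      using exp_weight_nonzero_imp_pos[OF False, of q] l[of q] by simp
    then show ?thesis by (rule mult_nonneg_nonneg[OF exp_weight_nonneg nonneg])
  qed simp
  have Q: "Q \<ge> 0" "(\<integral>\<^sup>+s. ennreal (exp_weight s * P (\<lambda>q. l q * s $ q)) \<partial>lborel) = ennreal Q"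
    using hb wP by (auto simp: has_bochner_integral_iff nn_integral_eq_integral intro: integral_nonneg)
  define w where "w = (\<lambda>c. ennreal (real n * c ^ (n - 1)) * indicator {0..} c)"
  have [measurable]: "w \<in> borel_measurable borel" unfolding w_def by measurable
  define G where "G = (\<lambda>(s::real^'q) c. if \<forall>q. c \<le> l q * s $ q then ennreal (exp_weight s) * ennreal (P (\<lambda>q. l q * s $ q - c)) else 0)"
  have [measurable]: "case_prod G \<in> borel_measurable (borel \<Otimes>\<^sub>M borel)"
    unfolding G_def by measurable
  have "ennreal (fact n / \<sigma> ^ n) * ennreal Q
      = (\<integral>\<^sup>+c. w c * ennreal (exp (- (c * \<sigma>))) * ennreal Q \<partial>lborel)"
    unfolding nn_integral_power_deriv_exp[OF n \<sigma>, symmetric] w_def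
    by (rule nn_integral_multc[symmetric]) measurable
  also have "\<dots> \<le> (\<integral>\<^sup>+c. \<integral>\<^sup>+s. w c * G s c \<partial>lborel \<partial>lborel)"
  proof (rule nn_integral_mono)
    fix c :: real
    show "w c * ennreal (exp (- (c * \<sigma>))) * ennreal Q \<le> (\<integral>\<^sup>+s. w c * G s c \<partial>lborel)"
    proof (cases "c \<ge> 0")
      case True
      \<comment> \<open>This translation turns \<open>l q * s $ q - c\<close> into
        \<open>l q * s $ q\<close>; its coordinates sum to \<open>c * \<sigma>\<close>, the exponent
        released by the weight.\<close>
      define d where "d = (\<chi> q. c / l q)"
      have "ennreal (exp (- (c * \<sigma>))) * ennreal Q
          = (\<integral>\<^sup>+s. ennreal (exp (- (c * \<sigma>))) * ennreal (exp_weight s * P (\<lambda>q. l q * s $ q)) \<partial>lborel)"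
        unfolding Q(2)[symmetric] by (rule nn_integral_cmult[symmetric]) measurable
      also have "\<dots> \<le> (\<integral>\<^sup>+s. G (d + s) c \<partial>lborel)"
      proof (rule nn_integral_mono)
        fix s :: "real^'q"
        show "ennreal (exp (- (c * \<sigma>))) * ennreal (exp_weight s * P (\<lambda>q. l q * s $ q)) \<le> G (d + s) c"
        proof (cases "exp_weight s = 0")
          case False
          have s: "s $ q > 0" for q using exp_weight_nonzero_imp_pos[OF False] .
          have d: "d $ q \<ge> 0" for q using True l[of q] by (simp add: d_def)
          have ld: "l q * (d + s) $ q = c + l q * s $ q" for q
            using l[of q] by (simp add: d_def field_simps)
          have "exp_weight (d + s) = (\<Prod>q\<in>UNIV. exp (- (d $ q)) * exp (- (s $ q)))"
            unfolding exp_weight_def using s d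
            by (intro prod.cong) (auto simp: add_nonneg_pos simp flip: exp_add)
          also have "\<dots> = exp (- (c * \<sigma>)) * exp_weight s"
            unfolding exp_weight_def using s
            by (simp add: prod.distrib exp_sum[symmetric] d_def \<sigma>_def sum_distrib_left sum_negf)
          finally have w: "exp_weight (d + s) = exp (- (c * \<sigma>)) * exp_weight s" .
          have "c \<le> c + l q * s $ q" for q using l[of q] s[of q] by simp
          then have "G (d + s) c = ennreal (exp_weight (d + s)) * ennreal (P (\<lambda>q. l q * s $ q))"
            unfolding G_def ld by simp
          then show ?thesis
            using wP[of s] exp_weight_nonneg[of s]
            by (simp add: w ennreal_mult' ennreal_mult'' mult.assoc)
        qed simp
      qed
      also have "\<dots> = (\<integral>\<^sup>+s. G s c \<partial>lborel)"
        by (rule nn_integral_lborel_translate[symmetric]) measurable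
      finally have "w c * (ennreal (exp (- (c * \<sigma>))) * ennreal Q) \<le> w c * (\<integral>\<^sup>+s. G s c \<partial>lborel)"
        by (rule mult_left_mono) simp
      also have "\<dots> = (\<integral>\<^sup>+s. w c * G s c \<partial>lborel)"
        by (rule nn_integral_cmult[symmetric]) measurable
      finally show ?thesis by (simp add: mult.assoc)
    qed (simp add: w_def)
  qed
  also have "\<dots> = (\<integral>\<^sup>+s. \<integral>\<^sup>+c. w c * G s c \<partial>lborel \<partial>lborel)"
    by (rule lborel_pair.Fubini') measurable
  also have "\<dots> \<le> (\<integral>\<^sup>+s. ennreal (exp_weight s * (C * (\<Prod>q\<in>UNIV. (l q * s $ q) ^ n))) \<partial>lborel)"
  proof (rule nn_integral_mono)
    fix s :: "real^'q"
    show "(\<integral>\<^sup>+c. w c * G s c \<partial>lborel) \<le> ennreal (exp_weight s * (C * (\<Prod>q\<in>UNIV. (l q * s $ q) ^ n)))"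
    proof (cases "exp_weight s = 0")
      case False
      have ls: "l q * s $ q \<ge> 0" for q
        using exp_weight_nonzero_imp_pos[OF False, of q] l[of q] by simp
      have "(\<integral>\<^sup>+c. w c * G s c \<partial>lborel) = (\<integral>\<^sup>+c. ennreal (exp_weight s) *
          (ennreal (real n * c ^ (n - 1)) * indicator {c. 0 \<le> c \<and> (\<forall>q. c \<le> l q * s $ q)} c
            * ennreal (P (\<lambda>q. l q * s $ q - c))) \<partial>lborel)"
        by (intro nn_integral_cong) (auto simp: w_def G_def indicator_def mult_ac)
      also have "\<dots> = ennreal (exp_weight s) *
          (\<integral>\<^sup>+c. ennreal (real n * c ^ (n - 1)) * indicator {c. 0 \<le> c \<and> (\<forall>q. c \<le> l q * s $ q)} c
            * ennreal (P (\<lambda>q. l q * s $ q - c)) \<partial>lborel)"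
        by (rule nn_integral_cmult) measurable
      also have "\<dots> \<le> ennreal (exp_weight s) * ennreal (C * (\<Prod>q\<in>UNIV. (l q * s $ q) ^ n))"
        by (intro mult_left_mono bound ls) simp
      finally show ?thesis
        by (simp add: ennreal_mult' exp_weight_nonneg)
    next
      case True
      then have "G s c = 0" for c by (simp add: G_def)
      then show ?thesis by simp
    qed
  qed
  also have "\<dots> = ennreal (C * (\<Prod>q\<in>UNIV. l q ^ n) * fact n ^ CARD('q))"
  proof -
    have "has_bochner_integral lborel (\<lambda>s. exp_weight s * (C * (\<Prod>q\<in>UNIV. (l q * s $ q) ^ n)))
       (C * (\<Prod>q\<in>UNIV. l q ^ n) * fact n ^ CARD('q))"
      using has_bochner_integral_mult_right[OF has_bochner_integral_exp_weight_monom[of "\<lambda>_::'q. n"],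
          of "C * (\<Prod>q\<in>UNIV. l q ^ n)"]
      by (simp add: monom_eval_def power_mult_distrib prod.distrib mult_ac)
    moreover have "exp_weight s * (C * (\<Prod>q\<in>UNIV. (l q * s $ q) ^ n)) \<ge> 0" for s
    proof (cases "exp_weight s = 0")
      case False
      have "l q * s $ q \<ge> 0" for q
        using exp_weight_nonzero_imp_pos[OF False, of q] l[of q] by simp
      then show ?thesis
        by (intro mult_nonneg_nonneg[OF exp_weight_nonneg] mult_nonneg_nonneg[OF C] prod_nonneg ballI zero_le_power)
    qed simp
    ultimately show ?thesis
      by (auto simp: has_bochner_integral_iff nn_integral_eq_integral)
  qed
  finally have "ennreal (fact n / \<sigma> ^ n * Q) \<le> ennreal (C * (\<Prod>q\<in>UNIV. l q ^ n) * fact n ^ CARD('q))"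
    using Q(1) \<sigma> by (subst ennreal_mult) auto
  moreover have "0 \<le> C * (\<Prod>q\<in>UNIV. l q ^ n) * fact n ^ CARD('q)"
    using l by (intro mult_nonneg_nonneg C prod_nonneg ballI zero_le_power less_imp_le) auto
  ultimately have "fact n / \<sigma> ^ n * Q \<le> C * (\<Prod>q\<in>UNIV. l q ^ n) * fact n ^ CARD('q)"
    by (simp only: ennreal_le_iff)
  then show ?thesis
    unfolding Q_def[symmetric] \<sigma>_def[symmetric] using \<sigma> by (simp add: field_simps)
qed

text \<open>Integrate \<open>laplace_bound\<close> once more against the exponential weight, now in
  the variables \<open>l\<close>. Each monomial on the left gains a second product of factorials,
  hence the square; on the right the reciprocal multinomial expansion makes the integrand
  polynomial.\<close>

lemma weighted_coefficient_sum_bound: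
  "fact n * (\<Sum>k\<in>J. a k * (\<Prod>q\<in>UNIV. fact (k q))\<^sup>2)
    \<le> C * fact n ^ CARD('q) * (\<Sum>j | (\<Sum>q\<in>(UNIV::'q set). j q) = n.
        fact n / (\<Prod>q\<in>UNIV. fact (j q)) * (\<Prod>q\<in>UNIV. fact (n - j q)))"
proof -
  define L where "L = (\<lambda>s::real^'q. exp_weight s *
     (\<Sum>k\<in>J. fact n * (a k * (\<Prod>q\<in>UNIV. fact (k q))) * monom_eval k (\<lambda>q. s $ q)))"
  define R where "R = (\<lambda>s::real^'q. exp_weight s * (\<Sum>j | (\<Sum>q\<in>(UNIV::'q set). j q) = n.
     C * fact n ^ CARD('q) * (fact n / (\<Prod>q\<in>UNIV. fact (j q))) * monom_eval (\<lambda>q. n - j q) (\<lambda>q. s $ q)))"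
  have L: "has_bochner_integral lborel L
      (\<Sum>k\<in>J. fact n * (a k * (\<Prod>q\<in>UNIV. fact (k q))) * (\<Prod>q\<in>UNIV. fact (k q)))"
    unfolding L_def by (rule has_bochner_integral_exp_weight_polynomial[OF J])
  have R: "has_bochner_integral lborel R (\<Sum>j | (\<Sum>q\<in>(UNIV::'q set). j q) = n.
     C * fact n ^ CARD('q) * (fact n / (\<Prod>q\<in>UNIV. fact (j q))) * (\<Prod>q\<in>UNIV. fact (n - j q)))"
    unfolding R_def
    by (rule has_bochner_integral_exp_weight_polynomial[OF finite_exponents_of_degree,
          where \<kappa> = "\<lambda>j q. n - j q"
            and a = "\<lambda>j. C * fact n ^ CARD('q) * (fact n / (\<Prod>q\<in>UNIV. fact (j q)))"])
  have "L s \<le> R s" for s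
  proof (cases "exp_weight s = 0")
    case False
    have s: "s $ q > 0" for q by (rule exp_weight_nonzero_imp_pos[OF False])
    show ?thesis
      unfolding L_def R_def
    proof (rule mult_left_mono[OF _ exp_weight_nonneg])
      show "(\<Sum>k\<in>J. fact n * (a k * (\<Prod>q\<in>UNIV. fact (k q))) * monom_eval k (\<lambda>q. s $ q))
        \<le> (\<Sum>j | (\<Sum>q\<in>(UNIV::'q set). j q) = n.
            C * fact n ^ CARD('q) * (fact n / (\<Prod>q\<in>UNIV. fact (j q))) * monom_eval (\<lambda>q. n - j q) (\<lambda>q. s $ q))"
        using laplace_bound[of "\<lambda>q. s $ q", OF s]
        unfolding multinomial_theorem_reciprocal[of "\<lambda>q. s $ q", OF s]
        by (simp add: sum_distrib_left mult_ac)
    qed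
  qed (simp add: L_def R_def)
  then have "integral\<^sup>L lborel L \<le> integral\<^sup>L lborel R"
    using L R by (intro integral_mono) (auto simp: has_bochner_integral_iff)
  then show ?thesis
    using L R by (simp add: has_bochner_integral_iff sum_distrib_left power2_eq_square mult_ac)
qed

end

section \<open>Mixed volumes of repeated bodies\<close>

lemma weighted_sum_scale:
  "weighted_sum K (\<lambda>q. c * r q) = (\<lambda>x. c *\<^sub>R x) ` weighted_sum K r"
proof (intro set_eqI iffI)
  fix z assume "z \<in> weighted_sum K (\<lambda>q. c * r q)"
  then obtain y x where x: "y \<in> K" "\<And>i. x $ i \<in> K"
      "\<And>i. z $ i = (c * r (Some i)) *\<^sub>R x $ i - (c * r None) *\<^sub>R y"
    unfolding mem_weighted_sum by blast
  define w where "w = (\<chi> i. r (Some i) *\<^sub>R x $ i - r None *\<^sub>R y)"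
  have "w \<in> weighted_sum K r"
    unfolding mem_weighted_sum using x by (auto simp: w_def)
  moreover have "z = c *\<^sub>R w"
    by (simp add: vec_eq_iff x(3) w_def scaleR_diff_right)
  ultimately show "z \<in> (\<lambda>x. c *\<^sub>R x) ` weighted_sum K r" by blast
next
  fix z assume "z \<in> (\<lambda>x. c *\<^sub>R x) ` weighted_sum K r"
  then obtain w where w: "z = c *\<^sub>R w" "w \<in> weighted_sum K r" by blast
  then obtain y x where x: "y \<in> K" "\<And>i. x $ i \<in> K"
      "\<And>i. w $ i = r (Some i) *\<^sub>R x $ i - r None *\<^sub>R y"
    unfolding mem_weighted_sum by blast
  show "z \<in> weighted_sum K (\<lambda>q. c * r q)"
    unfolding mem_weighted_sum w(1) using x
    by (intro bexI[of _ y] exI[of _ x]) (auto simp: scaleR_diff_right)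
qed

lemma volume_weighted_sum_scale:
  fixes K :: "'a::euclidean_space set" and r :: "'p::finite option \<Rightarrow> real"
  assumes "convex_body K" "c \<ge> 0"
  shows "measure lebesgue (weighted_sum K (\<lambda>q. c * r q))
    = c ^ DIM('a^'p) * measure lebesgue (weighted_sum K r)"
  unfolding weighted_sum_scale
  using measure_lebesgue_affine[of c 0 "weighted_sum K r"] assms(2) by simp

text \<open>If \<open>K\<close> has positive volume, the growth estimate bounds the polynomial by a
  constant times \<open>(1 + t) ^ DIM('a)\<close>; otherwise all volumes vanish.\<close>

lemma polynomial_on_volume_weighted_sum_degree:
  fixes K :: "'a::euclidean_space set" and r :: "'p::finite option \<Rightarrow> real"
  assumes K: "convex_body K" and r: "\<And>q. 0 \<le> r q"
  shows "polynomial_on DIM('a) {0..} (\<lambda>t. measure lebesgue (weighted_sum K (r(q := t))))"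
proof (cases "measure lebesgue K = 0")
  case True
  then show ?thesis
    using polynomial_on_const[of _ _ 0] by (simp add: volume_weighted_sum_degenerate[OF K])
next
  case False
  define M where "M = measure lebesgue K"
  have M: "M > 0" using False by (simp add: M_def zero_less_measure_iff)
  obtain p where p: "\<And>t. t \<in> {0..} \<Longrightarrow> measure lebesgue (weighted_sum K (r(q := t))) = poly p t"
    using polynomial_on_volume_weighted_sum[OF K, of r q] by (auto simp: polynomial_on_def)
  have "degree p \<le> DIM('a)"
  proof (rule degree_le_of_growth)
    fix t :: real assume t: "0 \<le> t"
    show "0 \<le> poly p t" using p[of t, symmetric] t by simp
    have "M * poly p t \<le> (\<Prod>q'\<in>UNIV. ((r(q := t)) q' + 1) ^ DIM('a) * M)"
      unfolding M_def using volume_weighted_sum_growth[OF K, of "r(q := t)"] r t p[of t] by simp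
    also have "\<dots> = (t + 1) ^ DIM('a) * M * (\<Prod>q'\<in>UNIV - {q}. (r q' + 1) ^ DIM('a) * M)"
      by (subst prod.remove[of UNIV q]) (auto intro!: prod.cong)
    finally show "poly p t \<le> (\<Prod>q'\<in>UNIV - {q}. (r q' + 1) ^ DIM('a) * M) * (1 + t) ^ DIM('a)"
      using M by (simp add: mult_ac add.commute)
  qed
  then show ?thesis unfolding polynomial_on_def using p by blast
qed

text \<open>The partial degree bound gives \<open>k q \<le> DIM('a)\<close> and homogeneity fixes
  the total degree. Together they make the exponents exactly the complements of the multi-indices in
  the final sum.\<close>

lemma volume_weighted_sum_polynomial:
  fixes K :: "'a::euclidean_space set"
  assumes K: "convex_body K"
  obtains a where "\<And>r :: 'p::finite option \<Rightarrow> real. (\<And>q. 0 \<le> r q) \<Longrightarrow>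
    measure lebesgue (weighted_sum K r) =
      (\<Sum>k | (\<forall>q. k q \<le> DIM('a)) \<and> (\<Sum>q\<in>UNIV. k q) = DIM('a^'p). a k * monom_eval k r)"
proof -
  obtain a where a: "\<And>r :: 'p option \<Rightarrow> real. (\<And>q. 0 \<le> r q) \<Longrightarrow>
      measure lebesgue (weighted_sum K r) = (\<Sum>k | \<forall>q. k q \<le> DIM('a). a k * monom_eval k r)"
    using separately_polynomial_imp_polynomial[where f = "\<lambda>r. measure lebesgue (weighted_sum K r)",
        OF polynomial_on_volume_weighted_sum_degree[OF K]] by blast
  show thesis
  proof (rule that)
    fix r :: "'p option \<Rightarrow> real" assume r: "\<And>q. 0 \<le> r q"
    show "measure lebesgue (weighted_sum K r) =
        (\<Sum>k | (\<forall>q. k q \<le> DIM('a)) \<and> (\<Sum>q\<in>UNIV. k q) = DIM('a^'p). a k * monom_eval k r)"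
    proof (rule homogeneous_polynomial_form[where f = "\<lambda>r. measure lebesgue (weighted_sum K r)"])
      show "measure lebesgue (weighted_sum K \<rho>) = (\<Sum>k | \<forall>q. k q \<le> DIM('a). a k * monom_eval k \<rho>)"
        if "\<And>i. 0 \<le> \<rho> i" for \<rho> :: "'p option \<Rightarrow> real" using a that .
      show "measure lebesgue (weighted_sum K (\<lambda>q. c * \<rho> q)) = c ^ DIM('a^'p) * measure lebesgue (weighted_sum K \<rho>)"
        if "0 \<le> c" for \<rho> :: "'p option \<Rightarrow> real" and c using volume_weighted_sum_scale[OF K that] .
    qed (rule r)
  qed
qed

section \<open>Collecting repeated bodies in Minkowski sums\<close>

lemma scaleR_add_image_convex:
  fixes S :: "'a::real_vector set"
  assumes "convex S" "0 \<le> s" "0 \<le> t"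
  shows "(\<lambda>x. (s + t) *\<^sub>R x) ` S = (\<lambda>x. s *\<^sub>R x) ` S + (\<lambda>x. t *\<^sub>R x) ` S"
proof
  show "(\<lambda>x. (s + t) *\<^sub>R x) ` S \<subseteq> (\<lambda>x. s *\<^sub>R x) ` S + (\<lambda>x. t *\<^sub>R x) ` S"
    by (auto simp: scaleR_add_left intro: set_plus_intro)
  show "(\<lambda>x. s *\<^sub>R x) ` S + (\<lambda>x. t *\<^sub>R x) ` S \<subseteq> (\<lambda>x. (s + t) *\<^sub>R x) ` S"
    using convex_shrink_mem[of S t "s + t"] assms by (auto elim!: set_plus_elim)
qed

lemma weighted_sum_increment:
  assumes K: "convex_body K" and r: "0 \<le> r q" and t: "0 \<le> t"
  shows "weighted_sum K (r(q := r q + t)) = weighted_sum K r + (\<lambda>x. t *\<^sub>R x) ` summand K q"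
proof -
  have S: "convex (summand K q)" using convex_body_summand[OF K, of q] by (simp add: convex_body_def)
  define R where "R = (\<Sum>q'\<in>UNIV - {q}. (\<lambda>x. r q' *\<^sub>R x) ` summand K q')"
  have "weighted_sum K (r(q := u)) = (\<lambda>x. u *\<^sub>R x) ` summand K q + R" for u
    unfolding weighted_sum_def R_def
    by (subst sum.remove[of UNIV q]) (auto intro!: arg_cong2[where f = "(+)"] sum.cong)
  from this[of "r q + t"] this[of "r q"] show ?thesis
    by (simp only: scaleR_add_image_convex[OF S r t] fun_upd_triv) (simp only: add_ac)
qed

lemma weighted_sum_zero: "convex_body K \<Longrightarrow> weighted_sum K (\<lambda>_. 0) = {0}"
  by (auto simp: mem_weighted_sum convex_body_def vec_eq_iff intro!: exI[of _ "\<chi> i. _"])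

text \<open>By convexity, dilates of the same body add up to one dilate by the sum of the factors.
  The volume thus depends on the parameters only through their sums over blocks of equal
  bodies.\<close>

lemma minkowski_sum_blocks:
  fixes blk :: "nat \<Rightarrow> 'p::finite option"
  assumes K: "convex_body K" and s: "\<And>l. 0 \<le> s l"
  shows "(\<Sum>l<m. (\<lambda>x. s l *\<^sub>R x) ` summand K (blk l)) = weighted_sum K (\<lambda>q. \<Sum>l<m. if blk l = q then s l else 0)"
proof (induction m)
  case 0
  then show ?case by (simp add: weighted_sum_zero[OF K] set_zero)
next
  case (Suc m)
  have "(\<lambda>q. \<Sum>l<Suc m. if blk l = q then s l else 0) =
     (\<lambda>q. \<Sum>l<m. if blk l = q then s l else 0)(blk m := (\<Sum>l<m. if blk l = blk m then s l else 0) + s m)"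
    by auto
  then show ?case
    using weighted_sum_increment[OF K, of "\<lambda>q. \<Sum>l<m. if blk l = q then s l else 0" "blk m" "s m"] s
    by (simp add: Suc sum_nonneg)
qed

section \<open>Iterated one-sided derivatives and mixed volumes as coefficients\<close>

lemma partial_deriv_eqI:
  assumes "0 \<le> s i" "\<And>t. 0 \<le> t \<Longrightarrow> f (s(i := t)) = h t"
    and "(h has_real_derivative D) (at (s i))"
  shows "partial_deriv i f s = D"
proof -
  have "(h has_vector_derivative D) (at (s i) within {0..})"
    using assms(3) by (metis has_field_derivative_at_within has_real_derivative_iff_has_vector_derivative)
  then have "((\<lambda>t. f (s(i := t))) has_vector_derivative D) (at (s i) within {0..})"
    by (rule has_vector_derivative_transform[rotated 2]) (use assms in auto)
  \<comment> \<open>Vector derivatives within a set are unique at its limit points; this includes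
    the endpoint \<open>s i = 0\<close>, where the derivative is one-sided.\<close>
  moreover have "s i islimpt {0..}"
  proof (rule connected_imp_perfect)
    show "{0::real..} \<noteq> {a}" for a
      by (metis atLeast_iff order_refl singletonD zero_le_one zero_neq_one)
  qed (use assms(1) in auto)
  ultimately show ?thesis
    unfolding partial_deriv_def
    by (intro vector_derivative_within) (auto simp: trivial_limit_within)
qed

lemma falling_binomial_Suc: "fact (Suc d) * real (k choose Suc d) = fact d * real (k choose d) * real (k - d)"
proof -
  have "Suc d * (k choose Suc d) = (k - d) * (k choose d)"
    using binomial_absorption[of d k] binomial_absorb_comp[of k d] by simp
  then have "real (Suc d) * real (k choose Suc d) = real (k - d) * real (k choose d)"
    by (metis of_nat_mult)
  then show ?thesis by (simp add: mult_ac)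
qed

text \<open>Each derivative in a variable of block \<open>q\<close> lowers the exponent of the block
  sum by one and extends the falling factorial \<open>fact d * (k q choose d)\<close>. That factor
  vanishes once \<open>d\<close> exceeds \<open>k q\<close>, which makes the truncated exponent
  harmless. The formula is needed at all nonnegative \<open>s\<close>, since the next derivative
  looks at nearby points.\<close>

lemma iterated_partial_deriv_blocks:
  fixes blk :: "nat \<Rightarrow> 'q::finite" and a :: "('q \<Rightarrow> nat) \<Rightarrow> real" and N :: nat
  defines "\<sigma> \<equiv> \<lambda>s q. \<Sum>l<N. if blk l = q then s l else (0::real)"
  assumes f: "\<And>s. (\<And>l. 0 \<le> s l) \<Longrightarrow> f s = (\<Sum>k\<in>J. a k * monom_eval k (\<sigma> s))"
    and "set ls \<subseteq> {..<N}" and "\<And>l. 0 \<le> s l"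
  shows "foldr partial_deriv ls f s = (\<Sum>k\<in>J. a k * (\<Prod>q\<in>UNIV.
     fact (count_list (map blk ls) q) * real (k q choose count_list (map blk ls) q)
       * \<sigma> s q ^ (k q - count_list (map blk ls) q)))"
  using assms(3,4)
proof (induction ls arbitrary: s)
  case Nil
  then show ?case by (simp add: f monom_eval_def)
next
  case (Cons i ls)
  define d where "d = count_list (map blk ls)"
  define b where "b = blk i"
  have i: "i < N" using Cons.prems by simp
  have upd: "\<sigma> (s(i := t)) q = \<sigma> s q + (if q = b then t - s i else 0)" for t q
  proof -
    have "\<sigma> (s(i := t)) q = (\<Sum>l<N. (if blk l = q then s l else 0) + (if l = i then (if blk i = q then t - s i else 0) else 0))"
      unfolding \<sigma>_def by (intro sum.cong) auto
    then show ?thesis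
      using i by (simp add: sum.distrib \<sigma>_def b_def)
  qed
  define c where "c = (\<lambda>k q. fact (d q) * real (k q choose d q))"
  define R where "R = (\<lambda>k. \<Prod>q\<in>UNIV - {b}. c k q * \<sigma> s q ^ (k q - d q))"
  have "partial_deriv i (foldr partial_deriv ls f) s
     = (\<Sum>k\<in>J. a k * (c k b * (real (k b - d b) * \<sigma> s b ^ (k b - d b - 1)) * R k))"
  \<comment> \<open>The chosen \<open>h\<close> is a polynomial in \<open>t\<close> on the whole
    line, hence differentiable from both sides even at \<open>s i = 0\<close>.\<close>
  proof (rule partial_deriv_eqI[where h = "\<lambda>t. \<Sum>k\<in>J. a k * (c k b * (\<sigma> s b + (t - s i)) ^ (k b - d b) * R k)"])
    show "0 \<le> s i" using Cons.prems by simp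
    fix t :: real assume t: "0 \<le> t"
    have "foldr partial_deriv ls f (s(i := t))
        = (\<Sum>k\<in>J. a k * (\<Prod>q\<in>UNIV. c k q * \<sigma> (s(i := t)) q ^ (k q - d q)))"
      unfolding c_def d_def using Cons.prems t by (intro Cons.IH) auto
    also have "\<dots> = (\<Sum>k\<in>J. a k * (c k b * (\<sigma> s b + (t - s i)) ^ (k b - d b) * R k))"
    proof (intro sum.cong refl arg_cong2[where f = "(*)"])
      fix k
      have "(\<Prod>q\<in>UNIV - {b}. c k q * \<sigma> (s(i := t)) q ^ (k q - d q)) = R k"
        unfolding R_def by (intro prod.cong) (auto simp: upd)
      then show "(\<Prod>q\<in>UNIV. c k q * \<sigma> (s(i := t)) q ^ (k q - d q))
          = c k b * (\<sigma> s b + (t - s i)) ^ (k b - d b) * R k"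
        by (subst prod.remove[of UNIV b]) (auto simp: upd)
    qed
    finally show "foldr partial_deriv ls f (s(i := t))
      = (\<Sum>k\<in>J. a k * (c k b * (\<sigma> s b + (t - s i)) ^ (k b - d b) * R k))" .
  next
    show "((\<lambda>t. \<Sum>k\<in>J. a k * (c k b * (\<sigma> s b + (t - s i)) ^ (k b - d b) * R k)) has_real_derivative
       (\<Sum>k\<in>J. a k * (c k b * (real (k b - d b) * \<sigma> s b ^ (k b - d b - 1)) * R k))) (at (s i))"
      by (auto intro!: derivative_eq_intros sum.cong)
  qed
  also have "\<dots> = (\<Sum>k\<in>J. a k * (\<Prod>q\<in>UNIV.
     fact (count_list (map blk (i # ls)) q) * real (k q choose count_list (map blk (i # ls)) q)
       * \<sigma> s q ^ (k q - count_list (map blk (i # ls)) q)))"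
  proof (intro sum.cong refl arg_cong2[where f = "(*)"])
    fix k :: "'q \<Rightarrow> nat"
    have "(\<Prod>q\<in>UNIV - {b}. fact (count_list (map blk (i # ls)) q) * real (k q choose count_list (map blk (i # ls)) q)
       * \<sigma> s q ^ (k q - count_list (map blk (i # ls)) q)) = R k"
      unfolding R_def c_def d_def by (intro prod.cong) (auto simp: b_def)
    moreover have "count_list (map blk (i # ls)) b = Suc (d b)"
      by (simp add: d_def b_def)
    ultimately show "c k b * (real (k b - d b) * \<sigma> s b ^ (k b - d b - 1)) * R k = (\<Prod>q\<in>UNIV.
     fact (count_list (map blk (i # ls)) q) * real (k q choose count_list (map blk (i # ls)) q)
       * \<sigma> s q ^ (k q - count_list (map blk (i # ls)) q))"
      using falling_binomial_Suc[of "d b" "k b"]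
      by (subst prod.remove[of UNIV b]) (simp_all add: c_def mult_ac del: fact_Suc)
  qed
  finally show ?case by simp
qed

text \<open>At the origin only the monomial \<open>k = count_list bs\<close> survives: a smaller
  exponent is killed by the binomial coefficient, a larger one by a positive power of 0.\<close>

lemma mixed_volume_blocks:
  fixes K :: "'a::euclidean_space set" and bs :: "'p::finite option list"
  assumes K: "convex_body K" and "finite J"
    and a: "\<And>r :: 'p option \<Rightarrow> real. (\<And>q. 0 \<le> r q) \<Longrightarrow>
      measure lebesgue (weighted_sum K r) = (\<Sum>k\<in>J. a k * monom_eval k r)"
    and J: "count_list bs \<in> J"
  shows "mixed_volume (map (summand K) bs)
    = a (count_list bs) * (\<Prod>q\<in>UNIV. fact (count_list bs q)) / fact (length bs)"
proof -
  define Ks where "Ks = map (summand K) bs"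
  define N where "N = length bs"
  define d where "d = count_list bs"
  have len: "length Ks = N" by (simp add: Ks_def N_def)
  have f: "volume_of_combination Ks s = (\<Sum>k\<in>J. a k * monom_eval k (\<lambda>q. \<Sum>l<N. if bs ! l = q then s l else 0))"
    if s: "\<And>l. 0 \<le> s l" for s
  proof -
    have "(\<Sum>l<N. (\<lambda>x. s l *\<^sub>R x) ` (Ks ! l)) = (\<Sum>l<N. (\<lambda>x. s l *\<^sub>R x) ` summand K (bs ! l))"
      by (intro sum.cong) (auto simp: Ks_def N_def)
    also have "\<dots> = weighted_sum K (\<lambda>q. \<Sum>l<N. if bs ! l = q then s l else 0)"
      by (rule minkowski_sum_blocks[OF K s])
    finally show ?thesis
      unfolding volume_of_combination_def len using s by (simp add: a sum_nonneg)
  qed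
  have map_bs: "map ((!) bs) [0..<N] = bs" by (simp add: N_def map_nth)
  have "foldr partial_deriv [0..<N] (volume_of_combination Ks) (\<lambda>_. 0)
    = (\<Sum>k\<in>J. a k * (\<Prod>q\<in>UNIV. fact (d q) * real (k q choose d q) * (\<Sum>l<N. if bs ! l = q then 0 else 0) ^ (k q - d q)))"
    using iterated_partial_deriv_blocks[where f = "volume_of_combination Ks" and J = J and a = a and N = N
        and blk = "(!) bs" and ls = "[0..<N]" and s = "\<lambda>_. 0"] f
    unfolding map_bs d_def by (auto simp: atLeast0LessThan)
  also have "\<dots> = (\<Sum>k\<in>J. if k = d then a d * (\<Prod>q\<in>UNIV. fact (d q)) else 0)"
  proof (intro sum.cong refl)
    fix k
    show "a k * (\<Prod>q\<in>UNIV. fact (d q) * real (k q choose d q) * (\<Sum>l<N. if bs ! l = q then 0 else 0) ^ (k q - d q))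
       = (if k = d then a d * (\<Prod>q\<in>UNIV. fact (d q)) else 0)"
    proof (cases "k = d")
      case False
      then obtain q where "k q \<noteq> d q" by auto
      then have "fact (d q) * real (k q choose d q) * (\<Sum>l<N. if bs ! l = q then 0 else 0 :: real) ^ (k q - d q) = 0"
        by (cases "k q < d q") (auto simp: binomial_eq_0 power_0_left)
      then have "(\<Prod>q\<in>UNIV. fact (d q) * real (k q choose d q) * (\<Sum>l<N. if bs ! l = q then 0 else 0 :: real) ^ (k q - d q)) = 0"
        by (intro prod_zero) auto
      then show ?thesis using False by simp
    qed simp
  qed
  also have "\<dots> = a d * (\<Prod>q\<in>UNIV. fact (d q))"
    using J \<open>finite J\<close> by (simp add: d_def)
  finally show ?thesis
    by (simp add: mixed_volume_def len[unfolded Ks_def] Ks_def N_def d_def)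
qed

lemma count_list_concat_replicate:
  assumes "inj_on g (set xs)" "distinct xs" "x \<in> set xs"
  shows "count_list (concat (map (\<lambda>i. replicate (m i) (g i)) xs)) (g x) = m x"
proof -
  have rep: "count_list (replicate k y) z = (if y = z then k else 0)" for k and y z :: 'b
    by (induction k) auto
  have "count_list (concat (map (\<lambda>i. replicate (m i) (g i)) xs)) (g x)
      = (\<Sum>i\<leftarrow>xs. if g i = g x then m i else 0)"
    by (induction xs) (auto simp: rep count_list_append)
  also have "\<dots> = (\<Sum>i\<in>set xs. if g i = g x then m i else 0)"
    using assms(2) by (rule sum_list_distinct_conv_sum_set)
  also have "\<dots> = (\<Sum>i\<in>set xs. if i = x then m i else 0)"
    using assms by (intro sum.cong) (auto dest: inj_onD)
  finally show ?thesis using assms(3) by simp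
qed

section \<open>Translation into multi-indices and comparison of coefficients\<close>

theorem corollary7p4:
  fixes K :: "(real ^ 'n) set" and n p :: nat and e :: "nat \<Rightarrow> 'p::finite"
  assumes "CARD('n) = n" and "n \<ge> 2"
    and "bij_betw e {1..p} (UNIV :: 'p set)"
    and "convex_body K"
  shows "(\<Sum>j\<in>multi_indices n p.
            inverse (multinomial (n * p) (map (\<lambda>a. n - a) j)) * mixed_W p e K j)
         \<le> fact n ^ p / fact (n * p) *
            (\<Sum>j\<in>multi_indices n p.
               inverse (multinomial (n * p) (map (\<lambda>a. n - a) j)) * multinomial n j
               * measure lebesgue K ^ p)"
proof -
  note K = assms(4)
  define M where "M = measure lebesgue K"
  have M: "M \<ge> 0" by (simp add: M_def)
  have p: "CARD('p) = p"
    using bij_betw_same_card[OF assms(3)] by simp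
  have dim: "DIM(real^'n) = n" "DIM((real^'n)^'p) = n * p"
    using assms(1) p by (simp_all add: mult.commute)
  \<comment> \<open>List position 0 belongs to the diagonal body, that is to \<open>None\<close>;
    its inverse \<open>pos\<close> translates multi-indices given as lists into functions on
    \<open>'p option\<close>.\<close>
  define idx where "idx = (\<lambda>i. if i = 0 then None else Some (e i))"
  have idx: "bij_betw idx {0..<p + 1} (UNIV :: 'p option set)"
  proof -
    have "inj_on idx {0..<p + 1}"
    proof (rule inj_onI)
      fix i j assume "i \<in> {0..<p + 1}" "j \<in> {0..<p + 1}" "idx i = idx j"
      then show "i = j"
        using inj_onD[OF bij_betw_imp_inj_on[OF assms(3)], of i j]
        by (auto simp: idx_def split: if_splits)
    qed
    moreover have "idx ` {0..<p + 1} = UNIV"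
    proof -
      have "q \<in> idx ` {0..<p + 1}" for q
      proof (cases q)
        case None
        then have "q = idx 0" by (simp add: idx_def)
        then show ?thesis by auto
      next
        case (Some y)
        have "y \<in> e ` {1..p}" using bij_betw_imp_surj_on[OF assms(3)] by simp
        then obtain i where "i \<in> {1..p}" "y = e i" by blast
        then have "q = idx i" "i \<in> {0..<p + 1}" using Some by (auto simp: idx_def)
        then show ?thesis by blast
      qed
      then show ?thesis by blast
    qed
    ultimately show ?thesis by (simp add: bij_betw_def)
  qed
  define pos where "pos = inv_into {0..<p + 1} idx"
  have pos: "pos q < p + 1" "idx (pos q) = q" for q
    using bij_betw_inv_into_right[OF idx, of q] bij_betw_apply[OF bij_betw_inv_into[OF idx], of q]
    by (simp_all add: pos_def)
  have pos_idx: "pos (idx i) = i" if "i < p + 1" for i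
    using bij_betw_inv_into_left[OF idx, of i] that by (simp add: pos_def)
  define J where "J = {k :: 'p option \<Rightarrow> nat. (\<forall>q. k q \<le> n) \<and> (\<Sum>q\<in>UNIV. k q) = n * p}"
  have J: "finite J"
    unfolding J_def by (rule finite_subset[OF _ finite_bounded_exponents[of n]]) auto
  obtain a where a: "\<And>r :: 'p option \<Rightarrow> real. (\<And>q. 0 \<le> r q) \<Longrightarrow>
      measure lebesgue (weighted_sum K r) = (\<Sum>k\<in>J. a k * monom_eval k r)"
  proof (rule volume_weighted_sum_polynomial[OF K])
    fix a assume "\<And>r :: 'p option \<Rightarrow> real. (\<And>q. 0 \<le> r q) \<Longrightarrow> measure lebesgue (weighted_sum K r) =
      (\<Sum>k | (\<forall>q. k q \<le> DIM(real^'n)) \<and> (\<Sum>q\<in>UNIV. k q) = DIM((real^'n)^'p). a k * monom_eval k r)"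
    then show thesis unfolding dim J_def[symmetric] by (rule that)
  qed
  interpret shifted_integral_bound J a n "M ^ p" "\<lambda>r. \<Sum>k\<in>J. a k * monom_eval k r"
  proof
    fix r :: "'p option \<Rightarrow> real" assume r: "\<And>q. 0 \<le> r q"
    show "0 \<le> (\<Sum>k\<in>J. a k * monom_eval k r)"
      using a[OF r, symmetric] by simp
    have "(\<integral>\<^sup>+c. ennreal (real n * c ^ (n - 1)) * indicator {c. 0 \<le> c \<and> (\<forall>q. c \<le> r q)} c
        * ennreal (\<Sum>k\<in>J. a k * monom_eval k (\<lambda>q. r q - c)) \<partial>lborel)
      = (\<integral>\<^sup>+c. ennreal (real n * c ^ (n - 1)) * indicator {c. 0 \<le> c \<and> (\<forall>q. c \<le> r q)} c
        * ennreal (measure lebesgue (weighted_sum K (\<lambda>q. r q - c))) \<partial>lborel)"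
      \<comment> \<open>The indicator restricts to levels with all \<open>r q - c \<ge> 0\<close>,
        where the polynomial formula for the volume is valid.\<close>
      by (intro nn_integral_cong) (auto simp: a indicator_def)
    then show "(\<integral>\<^sup>+c. ennreal (real n * c ^ (n - 1)) * indicator {c. 0 \<le> c \<and> (\<forall>q. c \<le> r q)} c
        * ennreal (\<Sum>k\<in>J. a k * monom_eval k (\<lambda>q. r q - c)) \<partial>lborel)
      \<le> ennreal (M ^ p * (\<Prod>q\<in>UNIV. r q ^ n))"
      using shifted_volume_integral_bound[OF K, of r] r unfolding dim p M_def by simp
  qed (use J M assms(2) in auto)
  define D where "D = {j :: 'p option \<Rightarrow> nat. (\<Sum>q\<in>UNIV. j q) = n}"
  have bij: "bij_betw (\<lambda>j q. j ! pos q) (multi_indices n p) D"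
  proof (rule bij_betw_byWitness[where f' = "\<lambda>j. map (\<lambda>i. j (idx i)) [0..<p + 1]"])
    show "\<forall>j\<in>multi_indices n p. map (\<lambda>i. j ! pos (idx i)) [0..<p + 1] = j"
      by (auto simp: multi_indices_def pos_idx intro!: nth_equalityI simp del: upt_Suc)
    show "\<forall>j\<in>D. (\<lambda>q. map (\<lambda>i. j (idx i)) [0..<p + 1] ! pos q) = j"
      using pos by (auto simp del: upt_Suc)
    have "(\<Sum>q\<in>UNIV. j ! pos q) = sum_list j" if "length j = p + 1" for j :: "nat list"
    proof -
      have "(\<Sum>q\<in>UNIV. j ! pos q) = (\<Sum>i\<in>{0..<p + 1}. j ! pos (idx i))"
        by (rule sum.reindex_bij_betw[OF idx, symmetric])
      also have "\<dots> = (\<Sum>i\<in>{0..<p + 1}. j ! i)"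
        by (intro sum.cong) (auto simp: pos_idx)
      finally show ?thesis by (simp add: sum_list_sum_nth that del: sum.op_ivl_Suc)
    qed
    then show "(\<lambda>j q. j ! pos q) ` multi_indices n p \<subseteq> D"
      by (auto simp: multi_indices_def D_def)
    have "sum_list (map (\<lambda>i. j (idx i)) [0..<p + 1]) = (\<Sum>q\<in>UNIV. j q)" for j :: "'p option \<Rightarrow> nat"
      using sum.reindex_bij_betw[OF idx, of j]
      by (simp add: interv_sum_list_conv_sum_set_nat del: upt_Suc sum.op_ivl_Suc)
    then show "(\<lambda>j. map (\<lambda>i. j (idx i)) [0..<p + 1]) ` D \<subseteq> multi_indices n p"
      by (auto simp: multi_indices_def D_def simp del: upt_Suc)
  qed
  have prod_list: "(\<Prod>x\<leftarrow>j. f x) = (\<Prod>q\<in>UNIV. f (j ! pos q))"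
    if "length j = p + 1" for j :: "nat list" and f :: "nat \<Rightarrow> real"
  proof -
    have "(\<Prod>q\<in>UNIV. f (j ! pos q)) = (\<Prod>i\<in>{0..<p + 1}. f (j ! pos (idx i)))"
      by (rule prod.reindex_bij_betw[OF idx, symmetric])
    also have "\<dots> = (\<Prod>i\<in>{0..<p + 1}. f (j ! i))"
      by (intro prod.cong) (auto simp: pos_idx)
    finally show ?thesis by (simp add: prod.list_conv_set_nth that del: prod.op_ivl_Suc)
  qed
  have complement: "(\<lambda>q. n - j q) \<in> J" if "j \<in> D" for j
  proof -
    have le: "j q \<le> n" for q using that by (auto simp: D_def intro: member_le_sum)
    \<comment> \<open>There are \<open>p + 1\<close> indices, so the complements sum to
      \<open>(p + 1) * n - n = n * p\<close>.\<close>
    have "(\<Sum>q\<in>UNIV. n - j q) + (\<Sum>q\<in>UNIV. j q) = (\<Sum>q\<in>(UNIV::'p option set). n)"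
      using le by (simp flip: sum.distrib)
    then have "(\<Sum>q\<in>UNIV. n - j q) = n * p"
      using that by (simp add: D_def p)
    then show ?thesis by (simp add: J_def)
  qed
  have bijc: "bij_betw (\<lambda>j q. n - j q) D J"
  proof (rule bij_betw_byWitness[where f' = "\<lambda>k q. n - k q"])
    show "\<forall>j\<in>D. (\<lambda>q. n - (n - j q)) = j"
      by (auto simp: D_def fun_eq_iff intro!: diff_diff_cancel intro: member_le_sum)
    show "\<forall>k\<in>J. (\<lambda>q. n - (n - k q)) = k"
      by (auto simp: J_def)
    show "(\<lambda>j q. n - j q) ` D \<subseteq> J" using complement by blast
    show "(\<lambda>k q. n - k q) ` J \<subseteq> D"
    proof (rule image_subsetI)
      fix k assume k: "k \<in> J"
      have "k q \<le> n" for q using k by (simp add: J_def)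
      then have "(\<Sum>q\<in>UNIV. n - k q) + (\<Sum>q\<in>UNIV. k q) = (\<Sum>q\<in>(UNIV::'p option set). n)"
        by (simp flip: sum.distrib)
      then show "(\<lambda>q. n - k q) \<in> D"
        using k by (simp add: J_def D_def p)
    qed
  qed
  have mixed: "mixed_W p e K j = a (\<lambda>q. n - j ! pos q) * (\<Prod>q\<in>UNIV. fact (n - j ! pos q)) / fact (n * p)"
    if "j \<in> multi_indices n p" for j
  proof -
    \<comment> \<open>The list of the bodies' indices in the order of \<open>mixed_W\<close>; its
      counts are the complement of \<open>j\<close> and therefore an exponent in
      \<open>J\<close>.\<close>
    define bs where "bs = concat (map (\<lambda>i. replicate (n - j ! i) (idx i)) [0..<p + 1])"
    have cnt: "count_list bs = (\<lambda>q. n - j ! pos q)"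
    proof
      fix q
      show "count_list bs q = n - j ! pos q"
        unfolding bs_def
        using count_list_concat_replicate[of idx "[0..<p + 1]" "pos q" "\<lambda>i. n - j ! i"] idx pos[of q]
        by (simp add: bij_betw_def del: upt_Suc)
    qed
    have cJ: "count_list bs \<in> J"
      unfolding cnt using complement bij_betw_apply[OF bij that] by simp
    have "length bs = (\<Sum>q\<in>UNIV. count_list bs q)"
      using sum_count_set[of bs UNIV] by simp
    then have len: "length bs = n * p" using cJ by (simp add: J_def)
    have "replicate (n - j ! 0) ((\<lambda>x. - (vec x :: real ^ 'n ^ 'p)) ` K)
         @ concat (map (\<lambda>i. replicate (n - j ! i) (axis (e i) ` K)) [1..<p + 1]) = map (summand K) bs"
    proof -
      have "[0..<p + 1] = 0 # [1..<p + 1]" by (simp add: upt_conv_Cons del: upt_Suc)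
      moreover have "map (summand K) (concat (map (\<lambda>i. replicate (n - j ! i) (idx i)) [1..<p + 1]))
         = concat (map (\<lambda>i. replicate (n - j ! i) (axis (e i) ` K)) [1..<p + 1])"
        unfolding map_concat by (intro arg_cong[where f = concat]) (auto simp: idx_def summand_def simp del: upt_Suc)
      ultimately show ?thesis
        unfolding bs_def by (simp add: idx_def summand_def del: upt_Suc)
    qed
    then have "mixed_W p e K j = mixed_volume (map (summand K) bs :: (real^'n^'p) set list)"
      by (simp only: mixed_W_def Let_def assms(1))
    then show ?thesis
      using mixed_volume_blocks[OF K J a cJ] by (simp add: cnt len)
  qed
  \<comment> \<open>The inverse multinomial and the mixed volume each contribute the product of the
    \<open>fact (n - j q)\<close> over \<open>fact (n * p)\<close>, which produces the
    squares.\<close>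
  have "(\<Sum>j\<in>multi_indices n p. inverse (multinomial (n * p) (map (\<lambda>a. n - a) j)) * mixed_W p e K j)
     = (\<Sum>j\<in>multi_indices n p. (\<lambda>j. a (\<lambda>q. n - j q) * (\<Prod>q\<in>UNIV. fact (n - j q))\<^sup>2 / (fact (n * p))\<^sup>2) (\<lambda>q. j ! pos q))"
  proof (intro sum.cong refl)
    fix j assume j: "j \<in> multi_indices n p"
    then have "length j = p + 1" by (simp add: multi_indices_def)
    then show "inverse (multinomial (n * p) (map (\<lambda>a. n - a) j)) * mixed_W p e K j
       = (\<lambda>j. a (\<lambda>q. n - j q) * (\<Prod>q\<in>UNIV. fact (n - j q))\<^sup>2 / (fact (n * p))\<^sup>2) (\<lambda>q. j ! pos q)"
      by (simp add: mixed[OF j] multinomial_def o_def prod_list[of j "\<lambda>x. fact (n - x)"] power2_eq_square)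
  qed
  also have "\<dots> = (\<Sum>j\<in>D. a (\<lambda>q. n - j q) * (\<Prod>q\<in>UNIV. fact (n - j q))\<^sup>2 / (fact (n * p))\<^sup>2)"
    by (rule sum.reindex_bij_betw[OF bij])
  also have "\<dots> = (\<Sum>k\<in>J. a k * (\<Prod>q\<in>UNIV. fact (k q))\<^sup>2 / (fact (n * p))\<^sup>2)"
    by (rule sum.reindex_bij_betw[OF bijc])
  also have "\<dots> = (\<Sum>k\<in>J. a k * (\<Prod>q\<in>UNIV. fact (k q))\<^sup>2) / (fact (n * p))\<^sup>2"
    by (simp add: sum_divide_distrib)
  also have "\<dots> \<le> M ^ p * fact n ^ p * (\<Sum>j\<in>D. fact n / (\<Prod>q\<in>UNIV. fact (j q)) * (\<Prod>q\<in>UNIV. fact (n - j q))) / (fact (n * p))\<^sup>2"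
  proof (rule divide_right_mono)
    \<comment> \<open>The index type \<open>'p option\<close> has \<open>p + 1\<close> elements, so
      the right side of the coefficient bound carries \<open>fact n ^ (p + 1)\<close>; one factor
      \<open>fact n\<close> cancels.\<close>
    have "fact n * (\<Sum>k\<in>J. a k * (\<Prod>q\<in>UNIV. fact (k q))\<^sup>2)
      \<le> fact n * (M ^ p * fact n ^ p * (\<Sum>j\<in>D. fact n / (\<Prod>q\<in>UNIV. fact (j q)) * (\<Prod>q\<in>UNIV. fact (n - j q))))"
      using weighted_coefficient_sum_bound by (simp add: D_def p mult_ac)
    then show "(\<Sum>k\<in>J. a k * (\<Prod>q\<in>UNIV. fact (k q))\<^sup>2)
      \<le> M ^ p * fact n ^ p * (\<Sum>j\<in>D. fact n / (\<Prod>q\<in>UNIV. fact (j q)) * (\<Prod>q\<in>UNIV. fact (n - j q)))"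
      by simp
  qed simp
  \<comment> \<open>One of the two factors \<open>fact (n * p)\<close> goes to the constant in
    front, the other to the inverse multinomial.\<close>
  also have "\<dots> = fact n ^ p / fact (n * p) * (\<Sum>j\<in>D. (\<Prod>q\<in>UNIV. fact (n - j q)) / fact (n * p)
      * (fact n / (\<Prod>q\<in>UNIV. fact (j q))) * M ^ p)"
    by (simp add: sum_distrib_left sum_divide_distrib power2_eq_square mult_ac)
  also have "(\<Sum>j\<in>D. (\<Prod>q\<in>UNIV. fact (n - j q)) / fact (n * p) * (fact n / (\<Prod>q\<in>UNIV. fact (j q))) * M ^ p)
     = (\<Sum>j\<in>multi_indices n p. (\<lambda>j. (\<Prod>q\<in>UNIV. fact (n - j q)) / fact (n * p)
        * (fact n / (\<Prod>q\<in>UNIV. fact (j q))) * M ^ p) (\<lambda>q. j ! pos q))"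
    by (rule sum.reindex_bij_betw[OF bij, symmetric])
  also have "\<dots> = (\<Sum>j\<in>multi_indices n p. inverse (multinomial (n * p) (map (\<lambda>a. n - a) j)) * multinomial n j * M ^ p)"
  proof (intro sum.cong refl)
    fix j assume j: "j \<in> multi_indices n p"
    then have "length j = p + 1" by (simp add: multi_indices_def)
    then show "(\<lambda>j. (\<Prod>q\<in>UNIV. fact (n - j q)) / fact (n * p)
        * (fact n / (\<Prod>q\<in>UNIV. fact (j q))) * M ^ p) (\<lambda>q. j ! pos q)
      = inverse (multinomial (n * p) (map (\<lambda>a. n - a) j)) * multinomial n j * M ^ p"
      by (simp add: multinomial_def o_def prod_list[of j "\<lambda>x. fact (n - x)"] prod_list[of j fact])
  qed
  finally show ?thesis by (simp add: M_def)
qed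

end
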